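(* Let $\Phi=(G,\varphi)$ be a $\mathbb{T}$-gain bicyclic graph (with $G$ connected) that has at least one pendant vertex but no pendant twins. Let $K$ denote the graph on $\{1,2,3,4\}$ with edges $12,13,23,24,34$; let $L$ denote the graph on $\{1,2,3,4,5\}$ with edges $12,23,34,14,25,35$ (a 4-cycle $1,2,3,4$ together with a vertex $5$ adjacent to the two adjacent vertices $2,3$); let $M$ denote the graph on $\{1,2,3,4,5\}$ with edges $12,14,23,34,25,45$ (so $M\cong K_{2,3}$). "The cycle $i_1,\dots,i_k$" means the gain cycle of $\Phi$ with edges $i_1i_2,\dots,i_{k-1}i_k,i_ki_1$. Then $r(\Phi)=4$ if and only if, up to isomorphism of the underlying graph (with vertices labelled accordingly), one of the following holds: - ($G_{12}$) $G$ is $K$ with one pendant vertex attached to the degree-2 vertex $4$, and the cycle $1,2,3$ is of Type E; - ($G_{13}$) $G$ is $K$ with one pendant vertex attached to one vertex of degree 3 of $K$, with arbitrary gains; - ($G_{14}$) $G$ is $K$ with one pendant vertex attached to each of the two vertices of degree 3 of $K$, with arbitrary gains; - ($G_{15},G_{16}$) $G$ is obtained from $K$ and a disjoint path $P_2$ by joining one end of $P_2$ by an edge to a vertex of $K$ (either a vertex of degree 2 or a vertex of degree 3 of $K$), the cycle $1,2,3$ is of Type E and the cycle $1,2,4,3$ is of Type A; - ($G_{17}$) $G$ is $L$ with one pendant vertex attached to vertex $5$, and the cycle $1,2,3,4$ is of Type A; - ($G_{18}$) $G$ is $M$ with one pendant vertex attached to the degree-2 vertex $5$, and the cycle $1,2,3,4$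 is of Type A; - ($G_{19}$) $G$ is $M$ with one pendant vertex attached to one vertex of degree 3 of $M$, with arbitrary gains; - ($G_{20}$) $G$ is $M$ with one pendant vertex attached to each of the two vertices of degree 3 of $M$, with arbitrary gains; - ($G_{21},G_{22}$) $G$ is obtained from $M$ and a disjoint path $P_2$ by joining one end of $P_2$ by an edge to a vertex of $M$ (either a vertex of degree 2 or a vertex of degree 3 of $M$), and the cycles $1,2,3,4$ and $1,2,5,4$ are both of Type A.
   Context: All graphs are finite and simple. Let $\mathbb{T}=\{z\in\mathbb{C}:|z|=1\}$. A $\mathbb{T}$-gain graph $\Phi=(G,\varphi)$ consists of a graph $G$ (the underlying graph) and a map $\varphi$ from the set of oriented edges of $G$ (each edge in both orientations) to $\mathbb{T}$ such that $\varphi(e_{ij})=\varphi(e_{ji})^{-1}=\overline{\varphi(e_{ji})}$, where $e_{ij}$ is the oriented edge from $v_i$ to $v_j$. Its adjacency matrix $A(\Phi)=(a_{ij})$ is the Hermitian matrix with $a_{ij}=\varphi(e_{ij})$ if $v_i,v_j$ are adjacent and $a_{ij}=0$ otherwise. The rank $r(\Phi)$ is the rank of $A(\Phi)$. A bicyclic graph is a connected graph whose number of edges equals its number of vertices plus one. A pendant vertex is a vertex of degree 1; two pendant vertices are pendant twins if they have the same neighbor. $P_2$ is the path on two vertices. Types of gain cycles. Let a gain cycle have vertices $v_1,\dots,v_n$ in cyclic order, with $w_i=\varphi(v_iv_{i+1})$ for $1\le i\le n-1$ and $w_n=\varphi(v_nv_1)$ (gains of the edges oriented in the indicated direction). For $n$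 even it is of Type A if $(-1)^{n/2}\overline{w_n}=w_1w_2\cdots w_{n-1}$, and of Type B otherwise. For $n$ odd it is of Type C, D or E according as $\operatorname{Re}\left((-1)^{(n-1)/2}w_1w_2\cdots w_n\right)$ is $>0$, $<0$ or $=0$. *)

theory Defs
  imports "HOL-Analysis.Analysis" "Graph_Theory.Graph_Theory"
begin

text \<open>
  A finite simple graph is a \<^locale>\<open>pair_graph\<close>: a finite, loop-free, symmetric digraph whose
  arcs are pairs of vertices. Its arcs are the oriented edges (each edge in both orientations),
  the degree of a vertex is its out-degree, and the edges proper are the two-element sets
  underlying the arcs.
\<close>

definition edges :: "'a pair_pre_digraph \<Rightarrow> 'a set set" where
  "edges G = (\<lambda>(u, w). {u, w}) ` parcs G"

definition bicyclic :: "'a pair_pre_digraph \<Rightarrow> bool" where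
  "bicyclic G \<longleftrightarrow> Digraph_Component.connected (with_proj G) \<and>
     card (edges G) = card (pverts G) + 1"

definition pendant :: "'a pair_pre_digraph \<Rightarrow> 'a \<Rightarrow> bool" where
  "pendant G u \<longleftrightarrow> u \<in> pverts G \<and> out_degree (with_proj G) u = 1"

definition pendant_twins :: "'a pair_pre_digraph \<Rightarrow> 'a \<Rightarrow> 'a \<Rightarrow> bool" where
  "pendant_twins G u w \<longleftrightarrow> pendant G u \<and> pendant G w \<and> u \<noteq> w \<and>
     (\<exists>x. (u, x) \<in> parcs G \<and> (w, x) \<in> parcs G)"

text \<open>
  \<open>\<phi> (u, w)\<close> is the gain of the edge oriented from \<open>u\<close> to \<open>w\<close>; the values of \<open>\<phi>\<close> outside the
  arcs of \<open>G\<close> are irrelevant.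
\<close>

locale gain_graph = pair_graph G for G :: "'a pair_pre_digraph" +
  fixes \<phi> :: "'a \<times> 'a \<Rightarrow> complex"
  assumes gain_unit: "(u, w) \<in> parcs G \<Longrightarrow> cmod (\<phi> (u, w)) = 1"
    and gain_inverse: "(u, w) \<in> parcs G \<Longrightarrow> \<phi> (u, w) = inverse (\<phi> (w, u))"

text \<open>
  The adjacency matrix with respect to an enumeration \<open>vs\<close> of the vertices by a finite index type
  (meant to be a bijection onto the vertex set).
\<close>

definition adjacency_matrix ::
    "'a pair_pre_digraph \<Rightarrow> ('a \<times> 'a \<Rightarrow> complex) \<Rightarrow> ('n::finite \<Rightarrow> 'a) \<Rightarrow> complex^'n^'n" where
  "adjacency_matrix G \<phi> vs =
     (\<chi> i j. if (vs i, vs j) \<in> parcs G then \<phi> (vs i, vs j) else 0)"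

text \<open>
  A gain cycle is given by the list \<open>[v\<^sub>1, \<dots>, v\<^sub>n]\<close> of its vertices in cyclic order; the list of
  gains is then \<open>[w\<^sub>1, \<dots>, w\<^sub>n]\<close> with \<open>w\<^sub>n\<close> the gain of the closing edge from \<open>v\<^sub>n\<close> to \<open>v\<^sub>1\<close>.
\<close>

definition cycle_gains :: "('a \<times> 'a \<Rightarrow> complex) \<Rightarrow> 'a list \<Rightarrow> complex list" where
  "cycle_gains \<phi> c = map \<phi> (zip c (rotate1 c))"

definition type_A :: "('a \<times> 'a \<Rightarrow> complex) \<Rightarrow> 'a list \<Rightarrow> bool" where
  "type_A \<phi> c \<longleftrightarrow> even (length c) \<and>
     (-1) ^ (length c div 2) * cnj (last (cycle_gains \<phi> c)) = prod_list (butlast (cycle_gains \<phi> c))"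

definition type_E :: "('a \<times> 'a \<Rightarrow> complex) \<Rightarrow> 'a list \<Rightarrow> bool" where
  "type_E \<phi> c \<longleftrightarrow> odd (length c) \<and>
     Re ((-1) ^ ((length c - 1) div 2) * prod_list (cycle_gains \<phi> c)) = 0"

text \<open>\<open>labelling f H G\<close>: the vertex map \<open>f\<close> is a graph isomorphism from \<open>H\<close> onto \<open>G\<close>.\<close>

definition pair_iso :: "('a \<Rightarrow> 'b) \<Rightarrow> ('a, 'a \<times> 'a, 'b, 'b \<times> 'b) digraph_isomorphism" where
  "pair_iso f = \<lparr> iso_verts = f, iso_arcs = map_prod f f, iso_head = snd, iso_tail = fst \<rparr>"

definition labelling :: "('a \<Rightarrow> 'b) \<Rightarrow> 'a pair_pre_digraph \<Rightarrow> 'b pair_pre_digraph \<Rightarrow> bool" where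
  "labelling f H G \<longleftrightarrow> pre_digraph.digraph_isomorphism (with_proj H) (pair_iso f) \<and>
     with_proj G = app_iso (pair_iso f) (with_proj H)"

text \<open>
  Each edge below is listed in one orientation only; \<^const>\<open>mk_symmetric\<close> adds the other.
\<close>

definition simple_graph :: "'a set \<Rightarrow> ('a \<times> 'a) set \<Rightarrow> 'a pair_pre_digraph" where
  "simple_graph V E = mk_symmetric (with_proj \<lparr> pverts = V, parcs = E \<rparr>)"

definition graph_K :: "nat pair_pre_digraph" where
  "graph_K = simple_graph {1, 2, 3, 4} {(1, 2), (1, 3), (2, 3), (2, 4), (3, 4)}"

definition graph_L :: "nat pair_pre_digraph" where
  "graph_L = simple_graph {1, 2, 3, 4, 5} {(1, 2), (2, 3), (3, 4), (1, 4), (2, 5), (3, 5)}"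

definition graph_M :: "nat pair_pre_digraph" where
  "graph_M = simple_graph {1, 2, 3, 4, 5} {(1, 2), (1, 4), (2, 3), (3, 4), (2, 5), (4, 5)}"

text \<open>
  In the next two constructions \<open>x\<close> and \<open>y\<close> are meant to be distinct and not vertices of \<open>H\<close>.
  In the second one the path on \<open>x\<close>, \<open>y\<close> is joined to \<open>H\<close> by the edge between \<open>u\<close> and \<open>x\<close>.
\<close>

definition attach_pendant :: "'a pair_pre_digraph \<Rightarrow> 'a \<Rightarrow> 'a \<Rightarrow> 'a pair_pre_digraph" where
  "attach_pendant H u x = simple_graph (pverts H \<union> {x}) (parcs H \<union> {(u, x)})"

definition attach_P2 :: "'a pair_pre_digraph \<Rightarrow> 'a \<Rightarrow> 'a \<Rightarrow> 'a \<Rightarrow> 'a pair_pre_digraph" where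
  "attach_P2 H u x y = simple_graph (pverts H \<union> {x, y}) (parcs H \<union> {(x, y), (u, x)})"

end

theory Submission
  imports Defs
begin

text \<open>
  Let \<open>u\<close> be a pendant vertex and \<open>v\<close> its neighbour. Removing both lowers the rank by 2
  (\<open>rank_pendant\<close>), so \<open>\<Phi>\<close> has rank 4 exactly when the core, the gain graph induced on the
  other vertices, has rank 2. For an edge \<open>p q\<close> the rows of \<open>p\<close> and \<open>q\<close> are independent, so rank 2
  means that they span all rows, which is the explicit identity
  \<open>a\<^sub>w\<^sub>x = a\<^sub>w\<^sub>q a\<^sub>q\<^sub>p a\<^sub>p\<^sub>x + a\<^sub>w\<^sub>p a\<^sub>p\<^sub>q a\<^sub>q\<^sub>x\<close> for all core vertices \<open>w\<close> and \<open>x\<close> (\<open>rank_2_iff\<close>,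
  \<open>rank_eq_4_iff\<close>).

  This identity is used in two ways. On a labelled graph it reduces to a few equations between gains,
  and these are equivalent to the Types A and E of the cycles of the core: Type E for a triangle,
  Type A for a 4-cycle, both conditions for \<open>K\<close> and two Type A conditions for \<open>M\<close>; a star
  imposes nothing. This settles, for every labelled graph in the list, when its rank is 4.

  It remains to see that rank 4 forces one of the listed graphs, and here only the vanishing of
  entries in the identity is needed. No core vertex is isolated in the core: it would be pendant at
  \<open>v\<close> and so a twin of \<open>u\<close>. By the identity, each core vertex is then adjacent to \<open>q\<close> only, to \<open>p\<close>
  only, or to both; these three classes \<open>P\<close>, \<open>Q\<close>, \<open>R\<close> are completely joined to each other, and \<open>P\<close>
  and \<open>Q\<close> are independent (\<open>shape_of_rank_eq_4\<close>). If \<open>v\<close> has \<open>s\<close> neighbours in the core, where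
  \<open>s \<ge> 1\<close> by connectedness, then counting edges of a bicyclic graph leaves six possibilities
  (\<open>card_cases\<close>): the core is a star (\<open>s = 3\<close>), a triangle or a 4-cycle (\<open>s = 2\<close>), or \<open>M\<close> or, in
  two ways, \<open>K\<close> (\<open>s = 1\<close>). Each way of joining \<open>v\<close> to the core is in the list; for the star, the
  absence of twins bounds the number of leaves.
\<close>

section \<open>Rank of matrices\<close>

text \<open>
  The row of \<open>u\<close> is a multiple of the unit vector at \<open>v\<close>, so it clears column \<open>v\<close> from every other
  row; outside row \<open>v\<close> this leaves the matrix without \<open>u\<close> and \<open>v\<close>. The rows of \<open>u\<close> and \<open>v\<close> are then the
  only ones with entries in the columns \<open>v\<close> and \<open>u\<close> and so contribute 2. Rows and columns are zeroed rather
  than deleted, which keeps the index type.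
\<close>

lemma rank_pendant:
  fixes A :: "'f::field^'n^'n"
  assumes uv: "u \<noteq> v"
    and row: "\<And>j. j \<noteq> v \<Longrightarrow> A $ u $ j = 0" and col: "\<And>j. j \<noteq> v \<Longrightarrow> A $ j $ u = 0"
    and nz: "A $ u $ v \<noteq> 0" "A $ v $ u \<noteq> 0"
  shows "rank A = rank (\<chi> i j. if i \<in> {u, v} \<or> j \<in> {u, v} then 0 else A $ i $ j) + 2"
proof -
  define B where "B = (\<chi> i j. if i \<in> {u, v} \<or> j \<in> {u, v} then 0 else A $ i $ j)"
  have rows: "rows C = range (\<lambda>i. C $ i)" for C :: "'f^'n^'n"
    by (auto simp: rows_def row_def vec_eq_iff full_SetCompr_eq)
  have B_row: "B $ w = A $ w - (A $ w $ v / A $ u $ v) *s A $ u" if "w \<noteq> u" "w \<noteq> v" for w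
    using that uv row col nz by (auto simp: B_def vec_eq_iff)
  have B_row_0: "B $ w = 0" if "w \<in> {u, v}" for w
    using that by (auto simp: B_def vec_eq_iff)
  let ?S = "insert (A $ u) (insert (A $ v) (rows B))"
  have "vec.span (rows A) = vec.span ?S"
  proof (rule vec.span_eq[THEN iffD2], intro conjI subsetI)
    fix x assume "x \<in> rows A"
    then obtain w where w: "x = A $ w" by (auto simp: rows)
    show "x \<in> vec.span ?S"
    proof (cases "w \<in> {u, v}")
      case True
      then show ?thesis using w by (auto intro: vec.span_base)
    next
      case False
      then have "x = B $ w + (A $ w $ v / A $ u $ v) *s A $ u"
        using B_row w by simp
      moreover have "B $ w \<in> ?S" "A $ u \<in> ?S"
        unfolding rows by blast+
      then have "B $ w + (A $ w $ v / A $ u $ v) *s A $ u \<in> vec.span ?S"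
        by (intro vec.span_add vec.span_scale vec.span_base)
      ultimately show ?thesis by simp
    qed
  next
    fix x assume "x \<in> ?S"
    then consider "x \<in> rows A" | w where "x = B $ w" "w \<notin> {u, v}" | "x = 0"
      unfolding rows using B_row_0 by blast
    then show "x \<in> vec.span (rows A)"
    proof cases
      case 2
      then have "x = A $ w - (A $ w $ v / A $ u $ v) *s A $ u"
        using B_row by simp
      moreover have "A $ w \<in> rows A" "A $ u \<in> rows A" by (auto simp: rows)
      then have "A $ w - (A $ w $ v / A $ u $ v) *s A $ u \<in> vec.span (rows A)"
        by (intro vec.span_diff vec.span_scale vec.span_base)
      ultimately show ?thesis by simp
    qed (auto intro: vec.span_base vec.span_zero)
  qed
  then have "rank A = vec.dim ?S"
    unfolding row_rank_def_gen by (metis vec.dim_span)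
  moreover have B_0: "x $ u = 0 \<and> x $ v = 0" if "x \<in> vec.span (rows B)" for x
    using that by (induction rule: vec.span_induct_alt) (auto simp: rows B_def)
  then have "A $ v \<notin> vec.span (rows B)"
    using nz by blast
  moreover have "A $ u \<notin> vec.span (insert (A $ v) (rows B))"
  proof
    assume "A $ u \<in> vec.span (insert (A $ v) (rows B))"
    then obtain k where "A $ u - k *s A $ v \<in> vec.span (rows B)"
      by (auto simp: vec.span_breakdown_eq)
    from B_0[OF this] show False
      using row[of u] uv nz by auto
  qed
  ultimately have "rank A = rank B + 2"
    by (simp add: vec.dim_insert row_rank_def_gen)
  then show ?thesis unfolding B_def .
qed

text \<open>
  Rows \<open>p\<close> and \<open>q\<close> are independent, so the rank is 2 exactly when they span all rows. The
  coefficients of row \<open>w\<close> in this basis can be read off in the columns \<open>q\<close> and \<open>p\<close>, where only one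
  of the two basis rows is nonzero. Thus rank 2 becomes an explicit identity between entries.
\<close>

lemma rank_2_iff:
  fixes B :: "'f::field^'n^'n"
  assumes diag: "B $ p $ p = 0" "B $ q $ q = 0"
    and nz: "B $ p $ q \<noteq> 0" "B $ q $ p \<noteq> 0"
  shows "rank B = 2 \<longleftrightarrow>
    (\<forall>w x. B $ w $ x = B $ w $ q / B $ p $ q * B $ p $ x + B $ w $ p / B $ q $ p * B $ q $ x)"
    (is "?L \<longleftrightarrow> ?R")
proof -
  have rows: "rows B = range (\<lambda>i. B $ i)"
    by (auto simp: rows_def row_def vec_eq_iff full_SetCompr_eq)
  let ?T = "{B $ p, B $ q}"
  have span_T: "x \<in> vec.span ?T \<longleftrightarrow> (\<exists>a b. x = a *s B $ p + b *s B $ q)" for x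
    by (auto simp: vec.span_breakdown_eq diff_eq_eq algebra_simps)
  have ne: "B $ p \<noteq> B $ q" using diag nz by metis
  have indep: "vec.independent ?T"
  proof (rule vec.independent_insertI)
    show "B $ p \<notin> vec.span {B $ q}"
      using diag nz by (auto simp: vec.span_singleton)
    show "vec.independent {B $ q}"
      using nz by (intro vec.independent_insertI) (auto simp: vec.independent_empty)
  qed
  have card: "card ?T = 2" using ne by simp
  have in_span: "B $ w \<in> vec.span ?T \<longleftrightarrow>
      B $ w = (B $ w $ q / B $ p $ q) *s B $ p + (B $ w $ p / B $ q $ p) *s B $ q" for w
  proof
    assume "B $ w \<in> vec.span ?T"
    then obtain a b where ab: "B $ w = a *s B $ p + b *s B $ q"
      using span_T by blast
    have "B $ w $ q = a * B $ p $ q" "B $ w $ p = b * B $ q $ p"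
      using diag by (simp_all add: ab)
    with ab nz diag show "B $ w = (B $ w $ q / B $ p $ q) *s B $ p + (B $ w $ p / B $ q $ p) *s B $ q"
      by simp
  qed (use span_T in blast)
  have "rank B = 2 \<longleftrightarrow> rows B \<subseteq> vec.span ?T"
  proof
    assume "rank B = 2"
    then show "rows B \<subseteq> vec.span ?T"
      using indep card by (intro vec.card_ge_dim_independent) (auto simp: row_rank_def_gen rows)
  next
    assume "rows B \<subseteq> vec.span ?T"
    moreover have "?T \<subseteq> rows B" by (auto simp: rows)
    ultimately show "rank B = 2"
      using indep card unfolding row_rank_def_gen by (metis vec.dim_unique)
  qed
  also have "\<dots> \<longleftrightarrow> ?R"
    by (auto simp: rows in_span image_subset_iff vec_eq_iff[of "B $ _"])
  finally show ?thesis .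
qed

section \<open>The rank of a gain graph with a pendant vertex\<close>

context gain_graph
begin

definition adj :: "'a \<Rightarrow> 'a \<Rightarrow> complex" where
  "adj x y = (if (x, y) \<in> parcs G then \<phi> (x, y) else 0)"

lemma adj_eq_0_iff: "adj x y = 0 \<longleftrightarrow> (x, y) \<notin> parcs G"
  using gain_unit[of x y] by (auto simp: adj_def)

lemma adj_self [simp]: "adj x x = 0"
  using no_loops' by (auto simp: adj_def)

lemma adj_inverse: "adj y x = inverse (adj x y)"
  using gain_inverse[of y x] arcs_symmetric by (auto simp: adj_def)

text \<open>
  The identity of \<open>rank_2_iff\<close> for a gain graph, where \<open>1 / adj p q = adj q p\<close>. It says nothing
  in the rows and columns of the edge itself, which leaves only the other vertices to be checked.
\<close>

lemma core_identity_at_edge: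
  assumes "(p, q) \<in> parcs G" and "w \<in> {p, q} \<or> x \<in> {p, q}"
  shows "adj w x = adj w q * adj q p * adj p x + adj w p * adj p q * adj q x"
proof -
  have "adj q p * adj p q = 1"
    using assms(1) adj_inverse[of q p] by (simp add: adj_eq_0_iff)
  then show ?thesis
    using assms(2) by (auto simp: mult.commute mult.left_commute)
qed

text \<open>
  Removing the pendant vertex \<open>u\<close> with its neighbour \<open>v\<close> lowers the rank by 2, so rank 4 means rank 2
  of the core, which is tested at one edge \<open>p q\<close>. The enumeration \<open>vs\<close> disappears here: from now on
  everything is expressed by gains between vertices.
\<close>

lemma rank_eq_4_iff:
  fixes vs :: "'n::finite \<Rightarrow> 'a"
  assumes bij: "bij_betw vs UNIV (pverts G)"
    and pend: "\<And>x. (u, x) \<in> parcs G \<longleftrightarrow> x = v"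
    and pq: "(p, q) \<in> parcs G" "p \<notin> {u, v}" "q \<notin> {u, v}"
  shows "rank (adjacency_matrix G \<phi> vs) = 4 \<longleftrightarrow>
    (\<forall>w \<in> pverts G - {u, v}. \<forall>x \<in> pverts G - {u, v}.
      adj w x = adj w q * adj q p * adj p x + adj w p * adj p q * adj q x)"
proof -
  have uv: "(u, v) \<in> parcs G" "(v, u) \<in> parcs G" "u \<noteq> v"
    using pend arcs_symmetric no_loops' by blast+
  define idx where "idx = inv vs"
  have vs: "vs (idx x) = x" if "x \<in> pverts G" for x
    using bij that unfolding idx_def bij_betw_def by (metis f_inv_into_f)
  have inj: "vs i = vs j \<longleftrightarrow> i = j" for i j
    using bij unfolding bij_betw_def by (meson injD)
  have inV: "vs i \<in> pverts G" for i
    using bij unfolding bij_betw_def by blast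
  have mem: "u \<in> pverts G" "v \<in> pverts G" "p \<in> pverts G" "q \<in> pverts G"
    using uv pq in_arcsD1 in_arcsD2 by blast+
  have [simp]: "vs (idx u) = u" "vs (idx v) = v" "vs (idx p) = p" "vs (idx q) = q"
    using vs mem by auto
  have eq_idx: "i = idx x \<longleftrightarrow> vs i = x" if "x \<in> pverts G" for x i
    using inj vs[OF that] by metis
  let ?A = "adjacency_matrix G \<phi> vs"
  have A: "?A $ i $ j = adj (vs i) (vs j)" for i j
    by (simp add: adjacency_matrix_def adj_def)
  define B where
    "B = (\<chi> i j. if i \<in> {idx u, idx v} \<or> j \<in> {idx u, idx v} then 0 else ?A $ i $ j)"
  have B_entry: "B $ i $ j = (if vs i \<in> {u, v} \<or> vs j \<in> {u, v} then 0 else adj (vs i) (vs j))" for i j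
    by (simp add: B_def A eq_idx mem)
  have "rank ?A = rank B + 2"
  unfolding B_def
  proof (rule rank_pendant)
    show "idx u \<noteq> idx v" using uv(3) by (metis \<open>vs (idx u) = u\<close> \<open>vs (idx v) = v\<close>)
    show "?A $ idx u $ j = 0" "?A $ j $ idx u = 0" if "j \<noteq> idx v" for j
      using that pend arcs_symmetric by (auto simp: A adj_eq_0_iff eq_idx mem)
    show "?A $ idx u $ idx v \<noteq> 0" "?A $ idx v $ idx u \<noteq> 0"
      using uv by (auto simp: A adj_eq_0_iff)
  qed
  also have "\<dots> = 4 \<longleftrightarrow> rank B = 2" by simp
  also have "\<dots> \<longleftrightarrow> (\<forall>w x. B $ w $ x = B $ w $ idx q / B $ idx p $ idx q * B $ idx p $ x +
      B $ w $ idx p / B $ idx q $ idx p * B $ idx q $ x)"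
    using pq arcs_symmetric[of p q] by (intro rank_2_iff) (auto simp: B_entry adj_eq_0_iff)
  also have "\<dots> \<longleftrightarrow> (\<forall>w \<in> pverts G - {u, v}. \<forall>x \<in> pverts G - {u, v}.
      adj w x = adj w q * adj q p * adj p x + adj w p * adj p q * adj q x)"
    (is "(\<forall>w x. ?P w x) \<longleftrightarrow> (\<forall>w \<in> ?H. \<forall>x \<in> ?H. ?Q w x)")
  proof -
    have div: "z / adj p q = z * adj q p" "z / adj q p = z * adj p q" for z
      by (simp_all only: divide_inverse adj_inverse[symmetric])
    have "?P i j \<longleftrightarrow> vs i \<in> {u, v} \<or> vs j \<in> {u, v} \<or> ?Q (vs i) (vs j)" for i j
      using pq uv(3) unfolding B_entry by (auto simp: div)
    then show ?thesis
      by (metis Diff_iff inV vs)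
  qed
  finally show ?thesis .
qed

end

section \<open>The model graphs and their labellings\<close>

lemma parcs_simple_graph: "parcs (simple_graph V E) = E \<union> E\<inverse>"
  and pverts_simple_graph: "pverts (simple_graph V E) = V"
  by (auto simp: simple_graph_def parcs_mk_symmetric)

lemma simple_graph_wf: "E \<subseteq> V \<times> V \<Longrightarrow> pair_wf_digraph (simple_graph V E)"
  by unfold_locales (auto simp: parcs_simple_graph pverts_simple_graph)

lemma attach_pendant_wf:
  "pair_wf_digraph H \<Longrightarrow> u \<in> pverts H \<Longrightarrow> pair_wf_digraph (attach_pendant H u x)"
  unfolding attach_pendant_def
  by (rule simple_graph_wf) (auto dest: pair_wf_digraph.in_arcsD1 pair_wf_digraph.in_arcsD2)

lemma attach_P2_wf:
  "pair_wf_digraph H \<Longrightarrow> u \<in> pverts H \<Longrightarrow> pair_wf_digraph (attach_P2 H u x y)"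
  unfolding attach_P2_def
  by (rule simple_graph_wf) (auto dest: pair_wf_digraph.in_arcsD1 pair_wf_digraph.in_arcsD2)

lemma graph_K_wf: "pair_wf_digraph graph_K"
  and graph_L_wf: "pair_wf_digraph graph_L"
  and graph_M_wf: "pair_wf_digraph graph_M"
  unfolding graph_K_def graph_L_def graph_M_def by (auto intro!: simple_graph_wf)

lemma converse_insert: "(insert (x, y) R)\<inverse> = insert (y, x) (R\<inverse>)"
  by auto

lemmas graph_simps = converse_insert
  attach_pendant_def attach_P2_def graph_K_def graph_L_def graph_M_def
  parcs_simple_graph pverts_simple_graph

text \<open>
  Well-formedness is what makes injectivity on the vertices carry over to the arcs.
\<close>

lemma labelling_iff:
  assumes "pair_wf_digraph H"
  shows "labelling f H G \<longleftrightarrow>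
    inj_on f (pverts H) \<and> pverts G = f ` pverts H \<and> parcs G = map_prod f f ` parcs H"
proof -
  have "inj_on (map_prod f f) (parcs H)" if "inj_on f (pverts H)"
  proof (rule inj_on_subset)
    show "inj_on (map_prod f f) (pverts H \<times> pverts H)"
      using that by (auto simp: inj_on_def)
    show "parcs H \<subseteq> pverts H \<times> pverts H"
      using assms by (auto dest: pair_wf_digraph.in_arcsD1 pair_wf_digraph.in_arcsD2)
  qed
  then show ?thesis
    using assms
    by (auto simp: labelling_def pair_iso_def pre_digraph.digraph_isomorphism_def app_iso_def
        with_proj_def wf_digraph_wp_iff[unfolded with_proj_def])
qed

lemma out_degree_eq: "out_degree (with_proj H) u = card {w. (u, w) \<in> parcs H}"
proof -
  have "out_arcs (with_proj H) u = Pair u ` {w. (u, w) \<in> parcs H}"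
    by (auto simp: out_arcs_def)
  then show ?thesis by (simp add: out_degree_def card_image inj_on_def)
qed

lemma out_degree_graph_K:
  "out_degree (with_proj graph_K) u = (if u \<in> {2, 3} then 3 else if u \<in> {1, 4} then 2 else 0)"
proof -
  have "{w. (1, w) \<in> parcs graph_K} = {2, 3}" "{w. (2, w) \<in> parcs graph_K} = {1, 3, 4}"
    "{w. (3, w) \<in> parcs graph_K} = {1, 2, 4}" "{w. (4, w) \<in> parcs graph_K} = {2, 3}"
    "u \<notin> {1, 2, 3, 4} \<Longrightarrow> {w. (u, w) \<in> parcs graph_K} = {}"
    by (auto simp: graph_simps)
  then show ?thesis by (auto simp: out_degree_eq simp del: One_nat_def)
qed

lemma out_degree_graph_M:
  "out_degree (with_proj graph_M) u = (if u \<in> {2, 4} then 3 else if u \<in> {1, 3, 5} then 2 else 0)"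
proof -
  have "{w. (1, w) \<in> parcs graph_M} = {2, 4}" "{w. (2, w) \<in> parcs graph_M} = {1, 3, 5}"
    "{w. (3, w) \<in> parcs graph_M} = {2, 4}" "{w. (4, w) \<in> parcs graph_M} = {1, 3, 5}"
    "{w. (5, w) \<in> parcs graph_M} = {2, 4}"
    "u \<notin> {1, 2, 3, 4, 5} \<Longrightarrow> {w. (u, w) \<in> parcs graph_M} = {}"
    by (auto simp: graph_simps)
  then show ?thesis by (auto simp: out_degree_eq simp del: One_nat_def)
qed

section \<open>Rank 4 of the labelled graphs\<close>

text \<open>
  The conjugate is the gain of the triangle in the other direction, so the equation is
  the rank 2 identity on the diagonal, at a vertex of the triangle.
\<close>

lemma type_E_3:
  "type_E \<phi> [x, y, z] \<longleftrightarrow>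
    cnj (\<phi> (x, y) * \<phi> (y, z) * \<phi> (z, x)) + \<phi> (x, y) * \<phi> (y, z) * \<phi> (z, x) = 0"
proof -
  have "Re w = 0 \<longleftrightarrow> cnj w + w = 0" for w by (simp add: complex_eq_iff)
  then show ?thesis
    by (simp add: type_E_def cycle_gains_def mult.assoc del: times_complex.sel)
qed

lemma type_A_4:
  "type_A \<phi> [w, x, y, z] \<longleftrightarrow> cnj (\<phi> (z, w)) = \<phi> (w, x) * \<phi> (x, y) * \<phi> (y, z)"
  by (simp add: type_A_def cycle_gains_def mult.assoc)

text \<open>
  The four identities for the core \<open>K\<close>, tested at the edge \<open>2 3\<close>; the variables are the gains of
  \<open>1 2\<close>, \<open>2 3\<close>, \<open>3 1\<close>, \<open>2 4\<close>, \<open>4 3\<close> and capital letters their inverses. The first identity is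
  Type E of the triangle \<open>1, 2, 3\<close>, that is \<open>(a * b * c)^2 = -1\<close>. Granted this, the
  second and the third, which are conjugate to each other, turn into \<open>C = a * d * e\<close>, Type A of the
  4-cycle \<open>1, 2, 4, 3\<close>. The last one is Type E of the triangle \<open>2, 4, 3\<close> and follows from these,
  since \<open>e * B * d\<close> is then the conjugate of \<open>a * b * c\<close>.
\<close>

lemma K_algebra:
  fixes a b c d e :: complex
  assumes "a * A = 1" "b * B = 1" "c * C = 1" "d * D = 1" "e * E = 1"
  shows "C * B * A + a * b * c = 0 \<and> C * B * d + a * b * E = 0 \<and>
      e * B * A + D * b * c = 0 \<and> e * B * d + D * b * E = 0 \<longleftrightarrow>
    C * B * A + a * b * c = 0 \<and> C = a * d * e"
  using assms by algebra

lemma C4_algebra: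
  fixes a b c d :: complex
  assumes "a * A = 1" "b * B = 1" "c * C = 1" "d * D = 1"
  shows "c = B * A * D \<and> C = d * a * b \<longleftrightarrow> D = a * b * c"
  using assms by algebra

context gain_graph
begin

lemma gain_cnj: "(x, y) \<in> parcs G \<Longrightarrow> \<phi> (x, y) = cnj (\<phi> (y, x))"
  using gain_unit[of y x] gain_inverse[of x y] arcs_symmetric
  by (simp add: inverse_complex_def complex_eq_iff power2_eq_square cmod_def)

lemma gain_mult: "(x, y) \<in> parcs G \<Longrightarrow> \<phi> (x, y) * \<phi> (y, x) = 1"
  using gain_unit[of y x] gain_inverse[of x y] arcs_symmetric[of x y]
  by (cases "\<phi> (y, x) = 0") auto

context
  fixes vs :: "'n::finite \<Rightarrow> 'a"
  assumes bij: "bij_betw vs UNIV (pverts G)"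
begin

text \<open>
  The criterion transported along a labelling: for a concrete \<open>H\<close> both the index sets and the
  adjacencies are evaluated by rewriting, which leaves equations between gains.
\<close>

lemma rank_eq_4_iff_labelling:
  assumes lab: "labelling f H G" and wf: "pair_wf_digraph H"
    and pend: "\<And>x. (u, x) \<in> parcs H \<longleftrightarrow> x = v"
    and pq: "(p, q) \<in> parcs H" "p \<notin> {u, v}" "q \<notin> {u, v}"
  shows "rank (adjacency_matrix G \<phi> vs) = 4 \<longleftrightarrow>
    (let b = \<lambda>i j. if (i, j) \<in> parcs H then \<phi> (f i, f j) else 0
     in \<forall>w \<in> pverts H - {u, v, p, q}. \<forall>x \<in> pverts H - {u, v, p, q}.
      b w x = b w q * b q p * b p x + b w p * b p q * b q x)"
proof -
  define I where "I = pverts H"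
  have inj: "inj_on f I" and V: "pverts G = f ` I" and E: "parcs G = map_prod f f ` parcs H"
    using lab by (simp_all add: labelling_iff[OF wf] I_def)
  have sub: "i \<in> I" "j \<in> I" if "(i, j) \<in> parcs H" for i j
    using that pair_wf_digraph.in_arcsD1[OF wf] pair_wf_digraph.in_arcsD2[OF wf]
    by (auto simp: I_def)
  have mem: "u \<in> I" "v \<in> I" "p \<in> I" "q \<in> I"
    using sub pend pq by blast+
  have arc_iff: "(f i, f j) \<in> parcs G \<longleftrightarrow> (i, j) \<in> parcs H" if "i \<in> I" "j \<in> I" for i j
    using that inj sub unfolding E by (auto simp: inj_on_eq_iff)
  have feq: "f i = f j \<longleftrightarrow> i = j" if "i \<in> I" "j \<in> I" for i j
    using that inj by (auto simp: inj_on_eq_iff)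
  define b where "b = (\<lambda>i j. if (i, j) \<in> parcs H then \<phi> (f i, f j) else 0)"
  have b: "adj (f i) (f j) = b i j" if "i \<in> I" "j \<in> I" for i j
    using that by (simp add: adj_def b_def arc_iff)
  have "rank (adjacency_matrix G \<phi> vs) = 4 \<longleftrightarrow>
    (\<forall>w \<in> pverts G - {f u, f v}. \<forall>x \<in> pverts G - {f u, f v}.
      adj w x = adj w (f q) * adj (f q) (f p) * adj (f p) x
        + adj w (f p) * adj (f p) (f q) * adj (f q) x)"
  proof (rule rank_eq_4_iff[OF bij])
    show "(f u, x) \<in> parcs G \<longleftrightarrow> x = f v" for x
      using arc_iff mem pend V in_arcsD2 by (metis imageE)
    show "(f p, f q) \<in> parcs G" using pq by (simp add: arc_iff mem)
    show "f p \<notin> {f u, f v}" "f q \<notin> {f u, f v}" using pq feq mem by auto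
  qed
  also have "\<dots> \<longleftrightarrow>
    (\<forall>w \<in> pverts G - {f u, f v, f p, f q}. \<forall>x \<in> pverts G - {f u, f v, f p, f q}.
      adj w x = adj w (f q) * adj (f q) (f p) * adj (f p) x
        + adj w (f p) * adj (f p) (f q) * adj (f q) x)"
  proof -
    have "(f p, f q) \<in> parcs G" using pq by (simp add: arc_iff mem)
    from core_identity_at_edge[OF this] show ?thesis by blast
  qed
  also have "pverts G - {f u, f v, f p, f q} = f ` (I - {u, v, p, q})"
    using inj mem V by (auto simp: inj_on_eq_iff)
  finally show ?thesis
    using mem by (simp add: b b_def[symmetric] I_def[symmetric])
qed

lemma rank_C3_core:
  assumes lab: "labelling f (attach_pendant graph_K 4 5) G"
  shows "rank (adjacency_matrix G \<phi> vs) = 4 \<longleftrightarrow> type_E \<phi> (map f [1, 2, 3])"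
proof -
  let ?H = "attach_pendant graph_K 4 5"
  have wf: "pair_wf_digraph ?H"
    by (intro attach_pendant_wf graph_K_wf) (simp add: graph_simps)
  have arcs: "(f 1, f 3) \<in> parcs G" "(f 3, f 2) \<in> parcs G" "(f 2, f 1) \<in> parcs G"
    using lab[unfolded labelling_iff[OF wf]] by (auto simp: graph_simps)
  have "rank (adjacency_matrix G \<phi> vs) = 4 \<longleftrightarrow>
      0 = \<phi> (f 1, f 3) * \<phi> (f 3, f 2) * \<phi> (f 2, f 1) + \<phi> (f 1, f 2) * \<phi> (f 2, f 3) * \<phi> (f 3, f 1)"
    by (subst rank_eq_4_iff_labelling[OF lab wf, where u = 5 and v = 4 and p = 2 and q = 3])
      (auto simp: graph_simps Let_def insert_Diff_if simp del: One_nat_def)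
  also have "\<dots> \<longleftrightarrow> type_E \<phi> (map f [1, 2, 3])"
    using arcs[THEN gain_cnj]
    by (simp add: type_E_3 mult_ac eq_commute[of 0] del: One_nat_def)
  finally show ?thesis .
qed

lemma rank_K_core:
  assumes lab: "labelling f (attach_P2 graph_K u 5 6) G" and u: "u \<in> pverts graph_K"
  shows "rank (adjacency_matrix G \<phi> vs) = 4 \<longleftrightarrow>
    type_E \<phi> (map f [1, 2, 3]) \<and> type_A \<phi> (map f [1, 2, 4, 3])"
proof -
  let ?H = "attach_P2 graph_K u 5 6"
  have wf: "pair_wf_digraph ?H"
    using u by (intro attach_P2_wf graph_K_wf)
  have u_ne: "u \<noteq> 5" "u \<noteq> 6" using u by (auto simp: graph_simps)
  have arcs: "(f 1, f 2) \<in> parcs G" "(f 2, f 3) \<in> parcs G" "(f 3, f 1) \<in> parcs G"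
    "(f 2, f 4) \<in> parcs G" "(f 4, f 3) \<in> parcs G"
    using lab[unfolded labelling_iff[OF wf]] by (auto simp: graph_simps)
  have "rank (adjacency_matrix G \<phi> vs) = 4 \<longleftrightarrow>
      \<phi> (f 1, f 3) * \<phi> (f 3, f 2) * \<phi> (f 2, f 1) + \<phi> (f 1, f 2) * \<phi> (f 2, f 3) * \<phi> (f 3, f 1) = 0 \<and>
      \<phi> (f 1, f 3) * \<phi> (f 3, f 2) * \<phi> (f 2, f 4) + \<phi> (f 1, f 2) * \<phi> (f 2, f 3) * \<phi> (f 3, f 4) = 0 \<and>
      \<phi> (f 4, f 3) * \<phi> (f 3, f 2) * \<phi> (f 2, f 1) + \<phi> (f 4, f 2) * \<phi> (f 2, f 3) * \<phi> (f 3, f 1) = 0 \<and>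
      \<phi> (f 4, f 3) * \<phi> (f 3, f 2) * \<phi> (f 2, f 4) + \<phi> (f 4, f 2) * \<phi> (f 2, f 3) * \<phi> (f 3, f 4) = 0"
    by (subst rank_eq_4_iff_labelling[OF lab wf, where u = 6 and v = 5 and p = 2 and q = 3])
      (use u_ne in \<open>simp_all add: graph_simps Let_def insert_Diff_if eq_commute[of 0] conj_ac del: One_nat_def\<close>)
  also have "\<dots> \<longleftrightarrow>
      \<phi> (f 1, f 3) * \<phi> (f 3, f 2) * \<phi> (f 2, f 1) + \<phi> (f 1, f 2) * \<phi> (f 2, f 3) * \<phi> (f 3, f 1) = 0 \<and>
      \<phi> (f 1, f 3) = \<phi> (f 1, f 2) * \<phi> (f 2, f 4) * \<phi> (f 4, f 3)"
    by (rule K_algebra) (use arcs in \<open>simp_all add: gain_mult\<close>)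
  also have "\<dots> \<longleftrightarrow> type_E \<phi> (map f [1, 2, 3]) \<and> type_A \<phi> (map f [1, 2, 4, 3])"
    using arcs[THEN arcs_symmetric, THEN gain_cnj]
    by (simp add: type_E_3 type_A_4 mult_ac del: One_nat_def)
  finally show ?thesis .
qed

text \<open>
  In both graphs, removing \<open>5\<close> and \<open>6\<close> leaves the 4-cycle \<open>1, 2, 3, 4\<close>.
\<close>

lemma rank_C4_core:
  assumes lab: "labelling f H G" and H: "H \<in> {attach_pendant graph_L 5 6, attach_pendant graph_M 5 6}"
  shows "rank (adjacency_matrix G \<phi> vs) = 4 \<longleftrightarrow> type_A \<phi> (map f [1, 2, 3, 4])"
proof -
  have "pair_wf_digraph (attach_pendant graph_L 5 6)" "pair_wf_digraph (attach_pendant graph_M 5 6)"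
    by (intro attach_pendant_wf graph_L_wf graph_M_wf; simp add: graph_simps)+
  then have wf: "pair_wf_digraph H" using H by blast
  have arcs: "(f 1, f 2) \<in> parcs G" "(f 2, f 3) \<in> parcs G" "(f 3, f 4) \<in> parcs G"
    "(f 4, f 1) \<in> parcs G"
    using lab[unfolded labelling_iff[OF wf]] H by (auto simp: graph_simps)
  have "rank (adjacency_matrix G \<phi> vs) = 4 \<longleftrightarrow>
      \<phi> (f 3, f 4) = \<phi> (f 3, f 2) * \<phi> (f 2, f 1) * \<phi> (f 1, f 4) \<and>
      \<phi> (f 4, f 3) = \<phi> (f 4, f 1) * \<phi> (f 1, f 2) * \<phi> (f 2, f 3)"
    using H
  proof (elim insertE emptyE)
    assume H: "H = attach_pendant graph_L 5 6"
    show ?thesis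
      by (subst rank_eq_4_iff_labelling[OF lab wf, where u = 6 and v = 5 and p = 1 and q = 2])
        (simp_all add: H graph_simps Let_def insert_Diff_if conj_ac del: One_nat_def)
  next
    assume H: "H = attach_pendant graph_M 5 6"
    show ?thesis
      by (subst rank_eq_4_iff_labelling[OF lab wf, where u = 6 and v = 5 and p = 1 and q = 2])
        (simp_all add: H graph_simps Let_def insert_Diff_if conj_ac del: One_nat_def)
  qed
  also have "\<dots> \<longleftrightarrow> \<phi> (f 1, f 4) = \<phi> (f 1, f 2) * \<phi> (f 2, f 3) * \<phi> (f 3, f 4)"
    by (rule C4_algebra) (use arcs in \<open>simp_all add: gain_mult\<close>)
  also have "\<dots> \<longleftrightarrow> type_A \<phi> (map f [1, 2, 3, 4])"
    using arcs[THEN arcs_symmetric, THEN gain_cnj]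
    by (simp add: type_A_4 del: One_nat_def)
  finally show ?thesis .
qed

lemma rank_K23_core:
  assumes lab: "labelling f (attach_P2 graph_M u 6 7) G" and u: "u \<in> pverts graph_M"
  shows "rank (adjacency_matrix G \<phi> vs) = 4 \<longleftrightarrow>
    type_A \<phi> (map f [1, 2, 3, 4]) \<and> type_A \<phi> (map f [1, 2, 5, 4])"
proof -
  let ?H = "attach_P2 graph_M u 6 7"
  have wf: "pair_wf_digraph ?H"
    using u by (intro attach_P2_wf graph_M_wf)
  have u_ne: "u \<noteq> 6" "u \<noteq> 7" using u by (auto simp: graph_simps)
  have arcs: "(f 1, f 2) \<in> parcs G" "(f 2, f 3) \<in> parcs G" "(f 3, f 4) \<in> parcs G"
    "(f 4, f 1) \<in> parcs G" "(f 2, f 5) \<in> parcs G" "(f 5, f 4) \<in> parcs G"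
    using lab[unfolded labelling_iff[OF wf]] by (auto simp: graph_simps)
  have "rank (adjacency_matrix G \<phi> vs) = 4 \<longleftrightarrow>
      (\<phi> (f 3, f 4) = \<phi> (f 3, f 2) * \<phi> (f 2, f 1) * \<phi> (f 1, f 4) \<and>
       \<phi> (f 4, f 3) = \<phi> (f 4, f 1) * \<phi> (f 1, f 2) * \<phi> (f 2, f 3)) \<and>
      (\<phi> (f 5, f 4) = \<phi> (f 5, f 2) * \<phi> (f 2, f 1) * \<phi> (f 1, f 4) \<and>
       \<phi> (f 4, f 5) = \<phi> (f 4, f 1) * \<phi> (f 1, f 2) * \<phi> (f 2, f 5))"
    by (subst rank_eq_4_iff_labelling[OF lab wf, where u = 7 and v = 6 and p = 1 and q = 2])
      (use u_ne in \<open>simp_all add: graph_simps Let_def insert_Diff_if conj_ac del: One_nat_def\<close>)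
  also have "\<dots> \<longleftrightarrow> \<phi> (f 1, f 4) = \<phi> (f 1, f 2) * \<phi> (f 2, f 3) * \<phi> (f 3, f 4) \<and>
      \<phi> (f 1, f 4) = \<phi> (f 1, f 2) * \<phi> (f 2, f 5) * \<phi> (f 5, f 4)"
    by (intro arg_cong2[where f = "(\<and>)"] C4_algebra) (use arcs in \<open>simp_all add: gain_mult\<close>)
  also have "\<dots> \<longleftrightarrow> type_A \<phi> (map f [1, 2, 3, 4]) \<and> type_A \<phi> (map f [1, 2, 5, 4])"
    using arcs[THEN arcs_symmetric, THEN gain_cnj]
    by (simp add: type_A_4 del: One_nat_def)
  finally show ?thesis .
qed

text \<open>
  A star has no cycles that could constrain the gains: at an edge of the star, all three terms
  of the identity vanish for any two other leaves.
\<close>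

lemma rank_eq_4_of_star_core:
  assumes lab: "labelling f H G" and wf: "pair_wf_digraph H"
    and pend: "\<And>x. (u, x) \<in> parcs H \<longleftrightarrow> x = v"
    and c: "c \<notin> {u, v}" "(c, q) \<in> parcs H" "q \<notin> {u, v, c}"
    and leaves: "\<And>x y. (x, y) \<in> parcs H \<Longrightarrow> x \<in> {v, c} \<or> y \<in> {v, c}"
  shows "rank (adjacency_matrix G \<phi> vs) = 4"
proof -
  have arcs: "(w, q) \<notin> parcs H" "(q, w) \<notin> parcs H" "(w, x) \<notin> parcs H"
    if "w \<notin> {u, v, c, q}" "x \<notin> {u, v, c, q}" for w x
    using that c leaves[of w q] leaves[of q w] leaves[of w x] by auto
  have q: "q \<notin> {u, v}" using c by simp
  show ?thesis
    by (subst rank_eq_4_iff_labelling[OF lab wf pend c(2) c(1) q]) (auto simp: Let_def arcs)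
qed

text \<open>
  In the remaining graphs a pendant vertex hangs at a vertex \<open>u\<close> of degree 3. Removing these two leaves a
  star whose centre is the other vertex of degree 3; for \<open>K\<close> with degree-3 vertices 2 and 3 this is
  \<open>5 - u\<close>, for \<open>M\<close> with 2 and 4 it is \<open>6 - u\<close>.
\<close>

lemma rank_K_pendant:
  assumes lab: "labelling f (attach_pendant graph_K u 5) G" and u: "u \<in> {2, 3}"
  shows "rank (adjacency_matrix G \<phi> vs) = 4"
  using u
  by (intro rank_eq_4_of_star_core[OF lab, of 5 u "5 - u" 1] attach_pendant_wf graph_K_wf)
    (auto simp: graph_simps)

lemma rank_K_two_pendants:
  assumes lab: "labelling f (attach_pendant (attach_pendant graph_K u 5) w 6) G"
    and u: "u \<in> {2, 3}" "w \<in> {2, 3}" "u \<noteq> w"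
  shows "rank (adjacency_matrix G \<phi> vs) = 4"
  using u
  by (intro rank_eq_4_of_star_core[OF lab, of 5 u w 1] attach_pendant_wf graph_K_wf)
    (auto simp: graph_simps)

lemma rank_M_pendant:
  assumes lab: "labelling f (attach_pendant graph_M u 6) G" and u: "u \<in> {2, 4}"
  shows "rank (adjacency_matrix G \<phi> vs) = 4"
  using u
  by (intro rank_eq_4_of_star_core[OF lab, of 6 u "6 - u" 1] attach_pendant_wf graph_M_wf)
    (auto simp: graph_simps)

lemma rank_M_two_pendants:
  assumes lab: "labelling f (attach_pendant (attach_pendant graph_M u 6) w 7) G"
    and u: "u \<in> {2, 4}" "w \<in> {2, 4}" "u \<noteq> w"
  shows "rank (adjacency_matrix G \<phi> vs) = 4"
  using u
  by (intro rank_eq_4_of_star_core[OF lab, of 6 u w 1] attach_pendant_wf graph_M_wf)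
    (auto simp: graph_simps)

end

end

section \<open>Bicyclic graphs over a multipartite core\<close>

text \<open>
  The underlying graphs of the theorem, with the vertices of attachment fixed up to the symmetries of
  \<open>K\<close> and \<open>M\<close>: 2, 3 and 2, 4 are their vertices of degree 3.
\<close>

definition rank_4_shape :: "'a pair_pre_digraph \<Rightarrow> bool" where
  "rank_4_shape G \<longleftrightarrow> (\<exists>f.
     labelling f (attach_pendant graph_K 4 5) G \<or>
     labelling f (attach_pendant graph_K 2 5) G \<or>
     labelling f (attach_pendant (attach_pendant graph_K 2 5) 3 6) G \<or>
     (\<exists>t \<in> pverts graph_K. labelling f (attach_P2 graph_K t 5 6) G) \<or>
     labelling f (attach_pendant graph_L 5 6) G \<or>
     labelling f (attach_pendant graph_M 5 6) G \<or>
     labelling f (attach_pendant graph_M 2 6) G \<or>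
     labelling f (attach_pendant (attach_pendant graph_M 2 6) 4 7) G \<or>
     (\<exists>t \<in> pverts graph_M. labelling f (attach_P2 graph_M t 6 7) G))"

lemma (in pair_graph) card_parcs: "card (parcs G) = 2 * card (edges G)"
proof -
  let ?s = "\<lambda>(u, w). {u, w}"
  have "card (parcs G) = (\<Sum>e \<in> edges G. card {a \<in> parcs G. ?s a = e})"
    unfolding edges_def by (subst card_eq_sum, subst sum.image_gen[of _ _ ?s])
      (simp_all add: pair_finite_arcs)
  also have "\<dots> = (\<Sum>e \<in> edges G. 2)"
  proof (rule sum.cong)
    fix e assume "e \<in> edges G"
    then obtain x y where xy: "(x, y) \<in> parcs G" "e = {x, y}"
      by (auto simp: edges_def)
    then have "{a \<in> parcs G. ?s a = e} = {(x, y), (y, x)}" "x \<noteq> y"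
      using arcs_symmetric no_loops' by (auto simp: doubleton_eq_iff)
    then show "card {a \<in> parcs G. ?s a = e} = 2" by simp
  qed simp
  finally show ?thesis by simp
qed

lemma (in pair_graph) connected_closed:
  assumes conn: "Digraph_Component.connected (with_proj G)"
    and X: "X \<subseteq> pverts G" "X \<noteq> {}" and closed: "\<And>x y. x \<in> X \<Longrightarrow> (x, y) \<in> parcs G \<Longrightarrow> y \<in> X"
  shows "X = pverts G"
proof -
  have "y \<in> X" if "y \<in> pverts G" for y
  proof -
    obtain x where x: "x \<in> X" using X by blast
    have "(x, y) \<in> rtrancl_on (pverts G) (parcs (mk_symmetric (with_proj G)))"
      using conn x X that
      by (auto simp: Digraph_Component.connected_def strongly_connected_def reachable_def)
    then show ?thesis
      using x by (induction rule: rtrancl_on_induct)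
        (use closed arcs_symmetric in \<open>auto simp: parcs_mk_symmetric\<close>)
  qed
  with X show ?thesis by blast
qed

lemma pendant_iff: "pendant G u \<longleftrightarrow> u \<in> pverts G \<and> (\<exists>v. \<forall>x. (u, x) \<in> parcs G \<longleftrightarrow> x = v)"
  by (auto simp: pendant_def out_degree_eq card_1_singleton_iff set_eq_iff)

text \<open>
  Between explicit finite sets, the four inclusions are decided by plain rewriting.
\<close>

lemma labellingI:
  assumes "pair_wf_digraph H" "inj_on f (pverts H)"
    "f ` pverts H \<subseteq> pverts G" "pverts G \<subseteq> f ` pverts H"
    "map_prod f f ` parcs H \<subseteq> parcs G" "parcs G \<subseteq> map_prod f f ` parcs H"
  shows "labelling f H G"
  using assms by (auto simp only: labelling_iff intro: equalityI)

text \<open>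
  A pendant vertex \<open>u\<close> at \<open>v\<close> and a core \<open>P \<union> Q \<union> R\<close> whose three classes are completely joined to each
  other, with \<open>P\<close> and \<open>Q\<close> independent. \<open>S\<close> is the set of neighbours of \<open>v\<close> in the core, and \<open>Z\<close>
  collects the arcs inside \<open>R\<close>, whose presence depends on the gains. As \<open>P\<close> and \<open>Q\<close> are
  interchangeable, \<open>card P \<le> card Q\<close> is assumed to halve the case analysis.
\<close>

locale pendant_core = pair_graph G for G :: "'a pair_pre_digraph" +
  fixes u v :: 'a and P Q R S :: "'a set" and Z :: "('a \<times> 'a) set"
  assumes verts: "pverts G = {u, v} \<union> (P \<union> Q \<union> R)"
    and uv: "u \<noteq> v" "u \<notin> P \<union> Q \<union> R" "v \<notin> P \<union> Q \<union> R"
    and disj: "P \<inter> Q = {}" "P \<inter> R = {}" "Q \<inter> R = {}"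
    and S: "S \<subseteq> P \<union> Q \<union> R"
    and Z: "Z \<subseteq> R \<times> R"
    and arcs: "parcs G = {(u, v), (v, u)} \<union> {v} \<times> S \<union> S \<times> {v} \<union> P \<times> Q \<union> Q \<times> P
      \<union> (P \<union> Q) \<times> R \<union> R \<times> (P \<union> Q) \<union> Z"
    and ne: "P \<noteq> {}" "Q \<noteq> {}" "S \<noteq> {}"
    and P_le_Q: "card P \<le> card Q"
    and bicyclic: "bicyclic G"
    and no_twins: "\<not> (\<exists>x y. pendant_twins G x y)"
begin

lemma fin: "finite P" "finite Q" "finite R" "finite S" "finite Z"
proof -
  show "finite P" "finite Q" "finite R"
    using pair_finite_verts by (simp_all add: verts)
  then show "finite S" "finite Z"
    using S Z by (auto intro: finite_subset)
qed

text \<open>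
  Twice the equation \<open>edges = vertices + 1\<close>; \<open>Z\<close> contains both arcs of each of its edges.
\<close>

lemma count:
  "2 * (card P * card Q + card R * (card P + card Q) + card S) + card Z
    = 2 * (card P + card Q + card R + 2)"
proof -
  have "card (parcs G) = 2 * (card (pverts G) + 1)"
    using bicyclic by (simp add: card_parcs bicyclic_def)
  moreover have "card (pverts G) = card P + card Q + card R + 2"
  proof -
    have "card (P \<union> Q \<union> R) = card P + card Q + card R"
      using disj fin by (subst card_Un_disjoint | force)+
    then show ?thesis using uv fin by (simp add: verts)
  qed
  moreover have "card (parcs G) = 2 + card S + card S + card P * card Q + card Q * card P
      + (card P + card Q) * card R + card R * (card P + card Q) + card Z"
  proof -
    have "card (P \<union> Q) = card P + card Q"
      using disj fin by (simp add: card_Un_disjoint)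
    moreover have "card {(u, v), (v, u)} = 2" using uv by simp
    moreover have "card (parcs G) = card {(u, v), (v, u)} + card ({v} \<times> S) + card (S \<times> {v})
        + card (P \<times> Q) + card (Q \<times> P) + card ((P \<union> Q) \<times> R) + card (R \<times> (P \<union> Q)) + card Z"
    proof -
      have d: "u \<notin> P" "u \<notin> Q" "u \<notin> R" "u \<notin> S" "v \<notin> P" "v \<notin> Q" "v \<notin> R" "v \<notin> S"
        using uv S by auto
      have e: "x \<in> P \<Longrightarrow> x \<in> Q \<Longrightarrow> False" "x \<in> P \<Longrightarrow> x \<in> R \<Longrightarrow> False"
          "x \<in> Q \<Longrightarrow> x \<in> R \<Longrightarrow> False" for x
        using disj by blast+
      have "({(u, v), (v, u)} \<union> {v} \<times> S \<union> S \<times> {v} \<union> P \<times> Q \<union> Q \<times> P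
          \<union> (P \<union> Q) \<times> R \<union> R \<times> (P \<union> Q)) \<inter> Z = {}"
        "({(u, v), (v, u)} \<union> {v} \<times> S \<union> S \<times> {v} \<union> P \<times> Q \<union> Q \<times> P
          \<union> (P \<union> Q) \<times> R) \<inter> R \<times> (P \<union> Q) = {}"
        "({(u, v), (v, u)} \<union> {v} \<times> S \<union> S \<times> {v} \<union> P \<times> Q \<union> Q \<times> P)
          \<inter> (P \<union> Q) \<times> R = {}"
        "({(u, v), (v, u)} \<union> {v} \<times> S \<union> S \<times> {v} \<union> P \<times> Q) \<inter> Q \<times> P = {}"
        "({(u, v), (v, u)} \<union> {v} \<times> S \<union> S \<times> {v}) \<inter> P \<times> Q = {}"
        "({(u, v), (v, u)} \<union> {v} \<times> S) \<inter> S \<times> {v} = {}"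
        "{(u, v), (v, u)} \<inter> {v} \<times> S = {}"
        using uv(1) d by (auto dest: e subsetD[OF Z])
      then show ?thesis
        unfolding arcs using fin by (simp only: card_Un_disjoint finite_Un finite_SigmaI finite.intros simp_thms)
    qed
    ultimately show ?thesis by (simp add: card_cartesian_product)
  qed
  ultimately show ?thesis by (simp add: algebra_simps)
qed

lemma Z_empty: "card R = 1 \<Longrightarrow> Z = {}"
proof -
  assume "card R = 1"
  then obtain r where "R = {r}" by (auto simp: card_1_singleton_iff)
  moreover have "(r, r) \<notin> Z" using no_loops' arcs by blast
  ultimately show "Z = {}" using Z by auto
qed

text \<open>
  Complete joins have too many edges for a bicyclic graph unless the classes are tiny. For \<open>R = {}\<close>
  the count reads \<open>(card P - 1) * (card Q - 1) = 3 - card S\<close>; each vertex of \<open>R\<close> adds at least two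
  edges to the core, so \<open>R\<close> has at most two elements. In the case names, \<open>K\<close> and \<open>K'\<close> both are the
  graph \<open>K\<close>, tested at an edge with one or two ends of degree 3.
\<close>

lemma card_cases:
  obtains
    (star) "card P = 1" "card R = 0" "card S = 3" "Z = {}"
  | (C4) "card P = 2" "card Q = 2" "card R = 0" "card S = 2" "Z = {}"
  | (K23) "card P = 2" "card Q = 3" "card R = 0" "card S = 1" "Z = {}"
  | (C3) "card P = 1" "card Q = 1" "card R = 1" "card S = 2" "Z = {}"
  | (K) "card P = 1" "card Q = 2" "card R = 1" "card S = 1" "Z = {}"
  | (K') "card P = 1" "card Q = 1" "card R = 2" "card S = 1" "Z = {}"
proof -
  have pos: "card P \<ge> 1" "card Q \<ge> 1" "card S \<ge> 1"
    using ne fin by (simp_all add: Suc_le_eq card_gt_0_iff)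
  have Z0: "card R = 0 \<Longrightarrow> Z = {}" using Z fin by auto
  have CZ: "card Z = 0 \<Longrightarrow> Z = {}" using fin by simp
  consider "card R = 0" | "card R = 1" | "card R = 2" | "card R \<ge> 3" by linarith
  then show ?thesis
  proof cases
    case 1
    with Z0 count have eq: "card P * card Q + card S = card P + card Q + 2" by simp
    consider "card P = 1" | "card P = 2" | "card P \<ge> 3" using pos by linarith
    then show ?thesis
    proof cases
      case a: 1
      with eq show ?thesis using star 1 Z0 by simp
    next
      case a: 2
      with eq pos P_le_Q have "card Q = 2 \<and> card S = 2 \<or> card Q = 3 \<and> card S = 1" by auto
      then show ?thesis using a C4 K23 1 Z0 by blast
    next
      case 3
      then have "3 * card Q \<le> card P * card Q" by simp
      with eq pos P_le_Q 3 show ?thesis by linarith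
    qed
  next
    case 2
    with Z_empty count have eq: "card P * card Q + card S = 3" by simp
    have "card P * 1 \<le> card P * card Q" "1 * card Q \<le> card P * card Q"
      using pos by (intro mult_le_mono; simp)+
    then have "card P \<le> 2" "card Q \<le> 2" using eq pos by linarith+
    then have "card P \<in> {1, 2}" "card Q \<in> {1, 2}" using pos by auto
    with eq pos P_le_Q show ?thesis using C3 K 2 Z_empty by auto
  next
    case 3
    with count have eq: "2 * (card P * card Q + card P + card Q + card S) + card Z = 8" by simp
    have lin: "m = 1 \<and> n = 1 \<and> s = 1 \<and> z = 0"
      if "2 * (a + m + n + s) + z = 8" "1 \<le> a" "1 \<le> m" "1 \<le> n" "1 \<le> s" for a m n s z :: nat
      using that by presburger
    have "1 \<le> card P * card Q" using mult_le_mono[OF pos(1,2)] by simp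
    from lin[OF eq this pos] have "card P = 1 \<and> card Q = 1 \<and> card S = 1 \<and> card Z = 0" .
    then show ?thesis using K' 3 CZ by blast
  next
    case 4
    have lin: False
      if "2 * (a + x + s) + z = 2 * (m + n + r + 2)" "1 \<le> a" "x = y + (m + n)" "(r - 1) * 2 \<le> y"
        "3 \<le> r" "1 \<le> s" for a m n r s x y z :: nat
      using that by presburger
    have "1 \<le> card P * card Q" using mult_le_mono[OF pos(1,2)] by simp
    moreover have "card R * (card P + card Q) = (card R - 1) * (card P + card Q) + (card P + card Q)"
      using 4 by (simp add: mult_eq_if)
    moreover have "(card R - 1) * 2 \<le> (card R - 1) * (card P + card Q)"
      using pos by (intro mult_le_mono) auto
    ultimately show ?thesis using lin[OF count _ _ _ 4 pos(3)] by blast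
  qed
qed

text \<open>
  Here \<open>v\<close> has three neighbours in the star. Leaves outside \<open>S\<close> are pendant vertices at the centre, so
  there is at most one. If the centre is in \<open>S\<close>, then \<open>v\<close>, the centre and two leaves form \<open>K\<close>; if not,
  \<open>v\<close> and the centre are the two degree-3 vertices of \<open>M\<close>.
\<close>

lemma shape_star:
  assumes "card P = 1" "card R = 0" "card S = 3" "Z = {}"
  shows "rank_4_shape G"
proof -
  have R: "R = {}" using assms fin by simp
  obtain p where P: "P = {p}" using assms by (auto simp: card_1_singleton_iff)
  have same: "x = y" if "x \<in> Q - S" "y \<in> Q - S" for x y
  proof (rule ccontr)
    assume "x \<noteq> y"
    moreover have "(w, z) \<in> parcs G \<longleftrightarrow> z = p" "w \<in> pverts G" if "w \<in> Q - S" for w z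
      using that uv disj S unfolding arcs verts P R assms(4) by auto
    ultimately have "pendant_twins G x y"
      using that unfolding pendant_twins_def pendant_iff by blast
    then show False using no_twins by blast
  qed
  have dist: "p \<noteq> u" "p \<noteq> v" "p \<notin> Q"
    "\<And>x. x \<in> Q \<Longrightarrow> x \<noteq> u" "\<And>x. x \<in> Q \<Longrightarrow> x \<noteq> v" "\<And>x. x \<in> Q \<Longrightarrow> x \<noteq> p"
    using uv disj P by auto
  show ?thesis
  proof (cases "p \<in> S")
    case True
    then have "card (S - {p}) = 2" using assms fin by simp
    then obtain a b where ab: "S - {p} = {a, b}" "a \<noteq> b" by (auto simp: card_2_iff)
    then have S_eq: "S = {p, a, b}" and abQ: "a \<in> Q" "b \<in> Q" using True S P R by auto
    note ne = uv(1) ab(2) dist(1,2) abQ[THEN dist(4)] abQ[THEN dist(5)] abQ[THEN dist(6)]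
    show ?thesis
    proof (cases "Q - S = {}")
      case True
      then have Q_eq: "Q = {a, b}" using S_eq abQ dist(3) by blast
      have "labelling ((\<lambda>_. u)(1 := a, 2 := v, 3 := p, 4 := b)) (attach_pendant graph_K 2 5) G"
        by (rule labellingI[OF attach_pendant_wf[OF graph_K_wf]])
          (use ne in \<open>simp_all add: graph_simps arcs verts P R Q_eq S_eq assms(4)\<close>)
      then show ?thesis unfolding rank_4_shape_def by blast
    next
      case False
      then obtain x where x: "x \<in> Q" "x \<notin> S" by blast
      have Q_eq: "Q = {a, b, x}" using same[of _ x] x abQ S_eq dist(3) by blast
      have "x \<noteq> a" "x \<noteq> b" using x S_eq by auto
      then have "labelling ((\<lambda>_. x)(1 := a, 2 := v, 3 := p, 4 := b, 5 := u))
          (attach_pendant (attach_pendant graph_K 2 5) 3 6) G"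
        by (intro labellingI attach_pendant_wf graph_K_wf)
          (use ne dist(4-6)[OF x(1)] in \<open>simp_all add: graph_simps arcs verts P R Q_eq S_eq assms(4)\<close>)
      then show ?thesis unfolding rank_4_shape_def by blast
    qed
  next
    case False
    obtain a b c where S_eq: "S = {a, b, c}" and abc: "a \<noteq> b" "a \<noteq> c" "b \<noteq> c"
      using assms(3) by (auto simp: card_3_iff)
    then have abcQ: "a \<in> Q" "b \<in> Q" "c \<in> Q" using False S P R by auto
    note ne = uv(1) abc dist(1,2) abcQ[THEN dist(4)] abcQ[THEN dist(5)] abcQ[THEN dist(6)]
    show ?thesis
    proof (cases "Q - S = {}")
      case True
      then have Q_eq: "Q = {a, b, c}" using S_eq abcQ dist(3) by blast
      have "labelling ((\<lambda>_. u)(1 := a, 2 := v, 3 := b, 4 := p, 5 := c)) (attach_pendant graph_M 2 6) G"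
        by (intro labellingI attach_pendant_wf graph_M_wf)
          (use ne in \<open>simp_all add: graph_simps arcs verts P R Q_eq S_eq assms(4)\<close>)
      then show ?thesis unfolding rank_4_shape_def by blast
    next
      case False
      then obtain x where x: "x \<in> Q" "x \<notin> S" by blast
      have Q_eq: "Q = {a, b, c, x}" using same[of _ x] x abcQ S_eq dist(3) by blast
      have "x \<noteq> a" "x \<noteq> b" "x \<noteq> c" using x S_eq by auto
      then have "labelling ((\<lambda>_. x)(1 := a, 2 := v, 3 := b, 4 := p, 5 := c, 6 := u))
          (attach_pendant (attach_pendant graph_M 2 6) 4 7) G"
        by (intro labellingI attach_pendant_wf graph_M_wf)
          (use ne dist(4-6)[OF x(1)] in \<open>simp_all add: graph_simps arcs verts P R Q_eq S_eq assms(4)\<close>)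
      then show ?thesis unfolding rank_4_shape_def by blast
    qed
  qed
qed

text \<open>
  The neighbours of \<open>v\<close> on the 4-cycle are opposite if they lie in the same class, which gives \<open>M\<close>,
  and adjacent otherwise, which gives \<open>L\<close>.
\<close>

lemma shape_C4:
  assumes "card P = 2" "card Q = 2" "card R = 0" "card S = 2" "Z = {}"
  shows "rank_4_shape G"
proof -
  have R: "R = {}" using assms fin by simp
  have dist: "\<And>x. x \<in> P \<union> Q \<Longrightarrow> x \<noteq> u \<and> x \<noteq> v" "\<And>x y. x \<in> P \<Longrightarrow> y \<in> Q \<Longrightarrow> x \<noteq> y"
    using uv disj by auto
  obtain s t where S_eq: "S = {s, t}" "s \<noteq> t" using assms(4) by (auto simp: card_2_iff)
  have other: "\<exists>y. X = {x, y} \<and> x \<noteq> y" if "card X = 2" "x \<in> X" for x :: 'a and X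
    using that by (auto simp: card_2_iff)
  have opposite: "rank_4_shape G"
    if "{A, B} = {P, Q}" "A = {s, t}" for A B
  proof -
    have "card B = 2" using that(1) assms by (auto simp: doubleton_eq_iff)
    then obtain b c where B: "B = {b, c}" "b \<noteq> c" by (auto simp: card_2_iff)
    have ne: "s \<noteq> u" "s \<noteq> v" "t \<noteq> u" "t \<noteq> v" "b \<noteq> u" "b \<noteq> v" "c \<noteq> u" "c \<noteq> v"
      "s \<noteq> b" "s \<noteq> c" "t \<noteq> b" "t \<noteq> c"
      using that B dist by (auto simp: doubleton_eq_iff)
    have "P = {s, t} \<and> Q = {b, c} \<or> P = {b, c} \<and> Q = {s, t}"
      using that B by (auto simp: doubleton_eq_iff)
    then have PQ: "P \<union> Q = {s, t, b, c}" "P \<times> Q \<union> Q \<times> P = {s, t} \<times> {b, c} \<union> {b, c} \<times> {s, t}"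
      by blast+
    have "parcs G = {(u, v), (v, u)} \<union> {v} \<times> {s, t} \<union> {s, t} \<times> {v}
        \<union> ({s, t} \<times> {b, c} \<union> {b, c} \<times> {s, t})"
      unfolding PQ(2)[symmetric] by (simp add: arcs R S_eq(1) assms(5) Un_assoc)
    then have "labelling ((\<lambda>_. u)(1 := b, 2 := s, 3 := c, 4 := t, 5 := v)) (attach_pendant graph_M 5 6) G"
      by (intro labellingI attach_pendant_wf graph_M_wf)
        (use ne uv(1) S_eq(2) B(2) in \<open>simp_all add: graph_simps verts PQ(1) R\<close>)
    then show ?thesis unfolding rank_4_shape_def by blast
  qed
  have adjacent: "rank_4_shape G"
    if st: "{A, B} = {P, Q}" "s \<in> A" "t \<in> B" for A B
  proof -
    have card: "card A = 2" "card B = 2" using that(1) assms by (auto simp: doubleton_eq_iff)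
    obtain a b where AB: "A = {s, a}" "s \<noteq> a" "B = {t, b}" "t \<noteq> b"
      using other[OF card(1) st(2)] other[OF card(2) st(3)] by blast
    have ne: "s \<noteq> u" "s \<noteq> v" "t \<noteq> u" "t \<noteq> v" "a \<noteq> u" "a \<noteq> v" "b \<noteq> u" "b \<noteq> v"
      "s \<noteq> b" "a \<noteq> t" "a \<noteq> b"
      using that AB dist by (auto simp: doubleton_eq_iff)
    have "P = {s, a} \<and> Q = {t, b} \<or> P = {t, b} \<and> Q = {s, a}"
      using that AB by (auto simp: doubleton_eq_iff)
    then have PQ: "P \<union> Q = {s, a, t, b}" "P \<times> Q \<union> Q \<times> P = {s, a} \<times> {t, b} \<union> {t, b} \<times> {s, a}"
      by blast+
    have "parcs G = {(u, v), (v, u)} \<union> {v} \<times> {s, t} \<union> {s, t} \<times> {v}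
        \<union> ({s, a} \<times> {t, b} \<union> {t, b} \<times> {s, a})"
      unfolding PQ(2)[symmetric] by (simp add: arcs R S_eq(1) assms(5) Un_assoc)
    then have "labelling ((\<lambda>_. u)(1 := b, 2 := s, 3 := t, 4 := a, 5 := v)) (attach_pendant graph_L 5 6) G"
      by (intro labellingI attach_pendant_wf graph_L_wf)
        (use ne uv(1) S_eq(2) AB(2,4) in \<open>simp_all add: graph_simps verts PQ(1) R\<close>)
    then show ?thesis unfolding rank_4_shape_def by blast
  qed
  have "s \<in> P \<union> Q" "t \<in> P \<union> Q" using S S_eq R by auto
  then consider "s \<in> P" "t \<in> P" | "s \<in> Q" "t \<in> Q" | "s \<in> P" "t \<in> Q" | "s \<in> Q" "t \<in> P" by blast
  then show ?thesis
  proof cases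
    case 1
    then have "P = {s, t}" using other[OF assms(1)] S_eq(2) by blast
    then show ?thesis using opposite[of P Q] by simp
  next
    case 2
    then have "Q = {s, t}" using other[OF assms(2)] S_eq(2) by blast
    then show ?thesis using opposite[of Q P] by (simp add: insert_commute)
  next
    case 3
    then show ?thesis using adjacent[of P Q] by simp
  next
    case 4
    then show ?thesis using adjacent[of Q P] by (simp add: insert_commute)
  qed
qed

lemma shape_K23:
  assumes "card P = 2" "card Q = 3" "card R = 0" "card S = 1" "Z = {}"
  shows "rank_4_shape G"
proof -
  have R: "R = {}" using assms fin by simp
  obtain a b where P: "P = {a, b}" "a \<noteq> b" using assms by (auto simp: card_2_iff)
  obtain c d e where Q: "Q = {c, d, e}" "c \<noteq> d" "c \<noteq> e" "d \<noteq> e"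
    using assms by (auto simp: card_3_iff)
  obtain s where s: "S = {s}" using assms by (auto simp: card_1_singleton_iff)
  let ?f = "(\<lambda>_::nat. u)(1 := c, 2 := a, 3 := d, 4 := b, 5 := e, 6 := v)"
  have ne: "a \<noteq> u" "a \<noteq> v" "b \<noteq> u" "b \<noteq> v" "c \<noteq> u" "c \<noteq> v" "d \<noteq> u" "d \<noteq> v" "e \<noteq> u" "e \<noteq> v"
    "a \<noteq> c" "a \<noteq> d" "a \<noteq> e" "b \<noteq> c" "b \<noteq> d" "b \<noteq> e"
    using uv disj by (auto simp: P(1) Q(1))
  have "s \<in> {c, a, d, b, e}" using S s P Q R by auto
  then have "s \<in> ?f ` {1, 2, 3, 4, 5}" by simp
  then obtain t where t: "t \<in> {1, 2, 3, 4, 5}" "s = ?f t" by (rule imageE)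
  have "labelling ?f (attach_P2 graph_M t 6 7) G"
    using t(1)
    by (intro labellingI attach_P2_wf graph_M_wf)
      (use ne uv(1) P(2) Q(2-4) in
        \<open>(elim insertE emptyE; simp add: graph_simps arcs verts P(1) Q(1) R s t(2) assms(5))+\<close>)
  then show ?thesis
    using t(1) unfolding rank_4_shape_def by (auto simp: graph_M_def pverts_simple_graph)
qed

lemma shape_C3:
  assumes "card P = 1" "card Q = 1" "card R = 1" "card S = 2" "Z = {}"
  shows "rank_4_shape G"
proof -
  obtain p q r where PQR: "P = {p}" "Q = {q}" "R = {r}"
    using assms by (auto simp: card_1_singleton_iff)
  obtain a b where S_eq: "S = {a, b}" "a \<noteq> b" using assms(4) by (auto simp: card_2_iff)
  have ne: "p \<noteq> u" "p \<noteq> v" "q \<noteq> u" "q \<noteq> v" "r \<noteq> u" "r \<noteq> v" "p \<noteq> q" "p \<noteq> r" "q \<noteq> r"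
    using uv disj by (auto simp: PQR)
  have "a \<in> {p, q, r}" "b \<in> {p, q, r}" using S by (auto simp: PQR S_eq)
  then obtain c where abc: "{p, q, r} = {a, b, c}" "c \<noteq> a" "c \<noteq> b"
    using S_eq(2) ne by (elim insertE emptyE) blast+
  have PQR_Un: "P \<union> Q \<union> R = {a, b, c}"
    using abc(1) by (simp add: PQR insert_commute)
  have "P \<times> Q \<union> Q \<times> P \<union> (P \<union> Q) \<times> R \<union> R \<times> (P \<union> Q)
      = {(x, y). x \<in> {p, q, r} \<and> y \<in> {p, q, r} \<and> x \<noteq> y}"
    using ne by (auto simp: PQR)
  also have "\<dots> = {(a, b), (b, a), (a, c), (c, a), (b, c), (c, b)}"
    unfolding abc(1) using S_eq(2) abc by auto
  finally have core: "P \<times> Q \<union> Q \<times> P \<union> (P \<union> Q) \<times> R \<union> R \<times> (P \<union> Q) = \<dots>" .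
  have "parcs G = {(u, v), (v, u)} \<union> {v} \<times> S \<union> S \<times> {v} \<union>
      (P \<times> Q \<union> Q \<times> P \<union> (P \<union> Q) \<times> R \<union> R \<times> (P \<union> Q))"
    by (simp add: arcs assms(5) Un_assoc)
  then have G_arcs: "parcs G = {(u, v), (v, u), (v, a), (v, b), (a, v), (b, v),
      (a, b), (b, a), (a, c), (c, a), (b, c), (c, b)}"
    unfolding core by (simp add: S_eq(1) insert_commute)
  have ne': "a \<noteq> u" "a \<noteq> v" "b \<noteq> u" "b \<noteq> v" "c \<noteq> u" "c \<noteq> v"
    using uv by (auto simp: PQR_Un)
  have "labelling ((\<lambda>_. u)(1 := c, 2 := a, 3 := b, 4 := v)) (attach_pendant graph_K 4 5) G"
    by (intro labellingI attach_pendant_wf graph_K_wf)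
      (use ne' uv(1) abc(2,3) S_eq(2) in \<open>simp_all add: graph_simps G_arcs verts PQR_Un\<close>)
  then show ?thesis unfolding rank_4_shape_def by blast
qed

text \<open>
  The two ways in which \<open>K\<close> arises from the classes, treated together.
\<close>

lemma shape_K_aux:
  assumes ne: "a \<noteq> b" "a \<noteq> c" "a \<noteq> d" "b \<noteq> c" "b \<noteq> d" "c \<noteq> d"
    and PQR: "P \<union> Q \<union> R = {a, b, c, d}" and S1: "card S = 1"
    and arcs': "P \<times> Q \<union> Q \<times> P \<union> (P \<union> Q) \<times> R \<union> R \<times> (P \<union> Q) =
      {(a, b), (b, a), (a, c), (c, a), (b, c), (c, b), (b, d), (d, b), (c, d), (d, c)}"
    and Z0: "Z = {}"
  shows "rank_4_shape G"
proof -
  obtain s where s: "S = {s}" using S1 by (auto simp: card_1_singleton_iff)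
  let ?f = "(\<lambda>_::nat. u)(1 := a, 2 := b, 3 := c, 4 := d, 5 := v)"
  have ne': "a \<noteq> u" "a \<noteq> v" "b \<noteq> u" "b \<noteq> v" "c \<noteq> u" "c \<noteq> v" "d \<noteq> u" "d \<noteq> v"
    using uv by (auto simp: PQR)
  have G_arcs: "parcs G = {(u, v), (v, u), (v, s), (s, v), (a, b), (b, a), (a, c), (c, a), (b, c), (c, b),
      (b, d), (d, b), (c, d), (d, c)}"
  proof -
    have "parcs G = {(u, v), (v, u)} \<union> {v} \<times> S \<union> S \<times> {v} \<union>
        (P \<times> Q \<union> Q \<times> P \<union> (P \<union> Q) \<times> R \<union> R \<times> (P \<union> Q))"
      by (simp add: arcs Z0 Un_assoc)
    then show ?thesis unfolding arcs' by (simp add: s insert_commute)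
  qed
  have "s \<in> {a, b, c, d}" using S s PQR by auto
  then have "s \<in> ?f ` {1, 2, 3, 4}" by simp
  then obtain t where t: "t \<in> {1, 2, 3, 4}" "s = ?f t" by (rule imageE)
  have "labelling ?f (attach_P2 graph_K t 5 6) G"
    using t(1)
    by (intro labellingI attach_P2_wf graph_K_wf)
      (use ne ne' uv(1) in
        \<open>(elim insertE emptyE; simp add: graph_simps G_arcs verts PQR t(2))+\<close>)
  then show ?thesis
    using t(1) unfolding rank_4_shape_def by (auto simp: graph_K_def pverts_simple_graph)
qed

lemma shape_K:
  assumes "card P = 1" "card Q = 2" "card R = 1" "card S = 1" "Z = {}"
  shows "rank_4_shape G"
proof -
  obtain p a b r where PQR: "P = {p}" "Q = {a, b}" "a \<noteq> b" "R = {r}"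
    using assms by (auto simp: card_1_singleton_iff card_2_iff)
  show ?thesis
    by (rule shape_K_aux[of a p r b]) (use PQR disj assms in \<open>auto\<close>)
qed

lemma shape_K':
  assumes "card P = 1" "card Q = 1" "card R = 2" "card S = 1" "Z = {}"
  shows "rank_4_shape G"
proof -
  obtain p q a b where PQR: "P = {p}" "Q = {q}" "R = {a, b}" "a \<noteq> b"
    using assms by (auto simp: card_1_singleton_iff card_2_iff)
  show ?thesis
    by (rule shape_K_aux[of a p q b]) (use PQR disj assms in \<open>auto\<close>)
qed

lemma rank_4_shape: "rank_4_shape G"
  using card_cases shape_star shape_C4 shape_K23 shape_C3 shape_K shape_K' by metis

end

section \<open>The shape forced by rank 4\<close>

context gain_graph
begin

text \<open>
  Gains are nonzero, so as soon as one of the two summands vanishes, the rank 2 identity determines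
  adjacency: a core vertex adjacent to just one end of the edge \<open>p q\<close> has the same neighbours as
  the other end. Only for two vertices adjacent to both ends can the summands cancel.
\<close>

lemma core_join:
  assumes ident: "adj w x = adj w q * adj q p * adj p x + adj w p * adj p q * adj q x"
    and pq: "(p, q) \<in> parcs G"
  shows "(w, q) \<notin> parcs G \<Longrightarrow> (w, p) \<notin> parcs G \<Longrightarrow> (w, x) \<notin> parcs G"
    and "(w, p) \<notin> parcs G \<Longrightarrow> (w, q) \<in> parcs G \<Longrightarrow> (w, x) \<in> parcs G \<longleftrightarrow> (p, x) \<in> parcs G"
    and "(w, q) \<notin> parcs G \<Longrightarrow> (w, p) \<in> parcs G \<Longrightarrow> (w, x) \<in> parcs G \<longleftrightarrow> (q, x) \<in> parcs G"
proof -
  have arc: "(y, z) \<in> parcs G \<longleftrightarrow> adj y z \<noteq> 0" for y z by (simp add: adj_eq_0_iff)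
  have "adj p q \<noteq> 0" "adj q p \<noteq> 0"
    using pq arcs_symmetric by (auto simp: adj_eq_0_iff)
  with ident show "(w, q) \<notin> parcs G \<Longrightarrow> (w, p) \<notin> parcs G \<Longrightarrow> (w, x) \<notin> parcs G"
    and "(w, p) \<notin> parcs G \<Longrightarrow> (w, q) \<in> parcs G \<Longrightarrow> (w, x) \<in> parcs G \<longleftrightarrow> (p, x) \<in> parcs G"
    and "(w, q) \<notin> parcs G \<Longrightarrow> (w, p) \<in> parcs G \<Longrightarrow> (w, x) \<in> parcs G \<longleftrightarrow> (q, x) \<in> parcs G"
    by (simp_all add: arc)
qed

text \<open>
  A core vertex without core neighbours would be pendant at \<open>v\<close> and hence a twin of \<open>u\<close>. So the core
  has an edge \<open>p q\<close>, and adjacency to its ends splits the core into the classes of \<open>pendant_core\<close>;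
  a vertex adjacent to neither end would be isolated by \<open>core_join\<close>.
\<close>

lemma shape_of_rank_eq_4:
  fixes vs :: "'n::finite \<Rightarrow> 'a"
  assumes bij: "bij_betw vs UNIV (pverts G)" and bicyclic: "bicyclic G"
    and pendant: "\<exists>u. pendant G u" and no_twins: "\<not> (\<exists>u w. pendant_twins G u w)"
    and rank: "rank (adjacency_matrix G \<phi> vs) = 4"
  shows "rank_4_shape G"
proof -
  note sym = arcs_symmetric
  obtain u v where u: "u \<in> pverts G" and uv: "\<And>x. (u, x) \<in> parcs G \<longleftrightarrow> x = v"
    using pendant by (auto simp: pendant_iff)
  have v: "v \<in> pverts G" "u \<noteq> v" and vu: "(v, u) \<in> parcs G"
    using uv[of v] in_arcsD2 no_loops' sym by blast+
  have xu: "(x, u) \<in> parcs G \<longleftrightarrow> x = v" for x using uv sym by blast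
  have conn: "Digraph_Component.connected (with_proj G)"
    and count: "card (parcs G) = 2 * (card (pverts G) + 1)"
    using bicyclic by (simp_all add: bicyclic_def card_parcs)
  define H where "H = pverts G - {u, v}"
  \<comment> \<open>a single edge is a tree and so not bicyclic\<close>
  have H_nonempty: "H \<noteq> {}"
  proof
    assume "H = {}"
    then have V: "pverts G = {u, v}" using u v by (auto simp: H_def)
    have "parcs G \<subseteq> {(u, v), (v, u)}"
    proof
      fix e assume "e \<in> parcs G"
      then obtain x y where "e = (x, y)" "x \<in> {u, v}" "y \<in> {u, v}" "x \<noteq> y"
        using in_arcsD1 in_arcsD2 no_loops' V by (metis surj_pair)
      then show "e \<in> {(u, v), (v, u)}" by auto
    qed
    from card_mono[OF _ this] show False
      using count v(2) by (simp add: V card_insert_if split: if_splits)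
  qed
  have core_neighbour: "\<exists>x \<in> H. (w, x) \<in> parcs G" if w: "w \<in> H" for w
  proof (rule ccontr)
    assume "\<not> ?thesis"
    then have only: "x = v" if "(w, x) \<in> parcs G" for x
      using that w xu in_arcsD2 by (auto simp: H_def)
    \<comment> \<open>otherwise \<open>w\<close> is isolated in \<open>G\<close>\<close>
    have "(w, v) \<in> parcs G"
    proof (rule ccontr)
      assume "(w, v) \<notin> parcs G"
      then have "{w} = pverts G"
        using only w by (intro connected_closed[OF conn]) (auto simp: H_def)
      then show False using u w by (auto simp: H_def)
    qed
    then have "(w, x) \<in> parcs G \<longleftrightarrow> x = v" for x using only by blast
    then have "pendant_twins G u w"
      using u uv w unfolding pendant_twins_def pendant_iff by (auto simp: H_def)
    with no_twins show False by blast
  qed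
  obtain p q where p: "p \<in> H" and q: "q \<in> H" and pq: "(p, q) \<in> parcs G"
    using H_nonempty core_neighbour by blast
  have "p \<notin> {u, v}" "q \<notin> {u, v}" using p q by (auto simp: H_def)
  then have "\<forall>w \<in> H. \<forall>x \<in> H. adj w x = adj w q * adj q p * adj p x + adj w p * adj p q * adj q x"
    using rank rank_eq_4_iff[OF bij uv pq] unfolding H_def by blast
  then have ident: "\<And>w x. w \<in> H \<Longrightarrow> x \<in> H \<Longrightarrow>
      adj w x = adj w q * adj q p * adj p x + adj w p * adj p q * adj q x" by blast
  note join = core_join[OF ident pq]
  define P where "P = {w \<in> H. (w, q) \<in> parcs G \<and> (w, p) \<notin> parcs G}"
  define Q where "Q = {w \<in> H. (w, p) \<in> parcs G \<and> (w, q) \<notin> parcs G}"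
  define R where "R = {w \<in> H. (w, p) \<in> parcs G \<and> (w, q) \<in> parcs G}"
  define S where "S = {w \<in> H. (v, w) \<in> parcs G}"
  define Z where "Z = parcs G \<inter> R \<times> R"
  have H_eq: "H = P \<union> Q \<union> R"
  proof -
    have "(w, p) \<in> parcs G \<or> (w, q) \<in> parcs G" if "w \<in> H" for w
      using join(1)[OF that] core_neighbour[OF that] by blast
    then show ?thesis by (auto simp: P_def Q_def R_def)
  qed
  have pP: "p \<in> P" and qQ: "q \<in> Q"
    using p q pq sym no_loops' by (auto simp: P_def Q_def)
  \<comment> \<open>otherwise the edge between \<open>u\<close> and \<open>v\<close> is a component of its own\<close>
  have S_nonempty: "S \<noteq> {}"
  proof
    assume "S = {}"
    then have "{u, v} = pverts G"
      using u v uv in_arcsD2 by (intro connected_closed[OF conn]) (auto simp: S_def H_def)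
    then show False using H_nonempty by (auto simp: H_def)
  qed
  have P_arcs: "(w, x) \<in> parcs G \<longleftrightarrow> x \<in> Q \<union> R" if "w \<in> P" "x \<in> H" for w x
    using that join(2)[of w x] sym by (auto simp: P_def Q_def R_def)
  have Q_arcs: "(w, x) \<in> parcs G \<longleftrightarrow> x \<in> P \<union> R" if "w \<in> Q" "x \<in> H" for w x
    using that join(3)[of w x] sym by (auto simp: P_def Q_def R_def)
  have disj: "P \<inter> Q = {}" "P \<inter> R = {}" "Q \<inter> R = {}"
    by (auto simp: P_def Q_def R_def)
  have verts: "pverts G = {u, v} \<union> (P \<union> Q \<union> R)"
    using u v H_eq by (auto simp: H_def)
  have notin: "u \<notin> P \<union> Q \<union> R" "v \<notin> P \<union> Q \<union> R"
    unfolding H_eq[symmetric] by (auto simp: H_def)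
  have arcs: "parcs G = {(u, v), (v, u)} \<union> {v} \<times> S \<union> S \<times> {v} \<union> P \<times> Q \<union> Q \<times> P
      \<union> (P \<union> Q) \<times> R \<union> R \<times> (P \<union> Q) \<union> Z" (is "_ = ?A")
  proof (rule set_eqI)
    fix e :: "'a \<times> 'a"
    obtain x y where e: "e = (x, y)" by fastforce
    consider "x = u" | "y = u" | "x = v" "y \<noteq> u" | "y = v" "x \<noteq> u"
      | "x \<in> H" "y \<in> H" | "x \<notin> pverts G" | "y \<notin> pverts G"
      by (auto simp: H_def)
    then show "e \<in> parcs G \<longleftrightarrow> e \<in> ?A"
    proof cases
      case 1
      then show ?thesis using uv v notin by (auto simp: e Z_def S_def H_def)
    next
      case 2
      then show ?thesis using xu v notin by (auto simp: e Z_def S_def H_def)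
    next
      case 3
      have "(v, y) \<in> parcs G \<longleftrightarrow> y \<in> S"
        using 3 in_arcsD2[of v y] no_loops' by (auto simp: S_def H_def)
      then show ?thesis using 3 v notin by (auto simp: e Z_def S_def H_def)
    next
      case 4
      have "(x, v) \<in> parcs G \<longleftrightarrow> x \<in> S"
        using 4 in_arcsD1[of x v] no_loops' sym by (auto simp: S_def H_def)
      then show ?thesis using 4 v notin by (auto simp: e Z_def S_def H_def)
    next
      case 5
      then have ne: "x \<noteq> u" "x \<noteq> v" "y \<noteq> u" "y \<noteq> v" by (auto simp: H_def)
      consider "x \<in> P" | "x \<in> Q" | "x \<in> R" "y \<in> P" | "x \<in> R" "y \<in> Q" | "x \<in> R" "y \<in> R"
        using 5 H_eq by blast
      then show ?thesis
      proof cases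
        case 1
        then show ?thesis using P_arcs[of x y] 5 ne disj by (auto simp: e Z_def)
      next
        case 2
        then show ?thesis using Q_arcs[of x y] 5 ne disj by (auto simp: e Z_def)
      next
        case 3
        then have "(x, y) \<in> parcs G" using P_arcs[of y x] 5 sym by blast
        then show ?thesis using 3 by (auto simp: e)
      next
        case 4
        then have "(x, y) \<in> parcs G" using Q_arcs[of y x] 5 sym by blast
        then show ?thesis using 4 by (auto simp: e)
      next
        case 5
        then show ?thesis using ne disj by (auto simp: e Z_def)
      qed
    next
      case 6
      then have "x \<notin> {u, v}" "x \<notin> P" "x \<notin> Q" "x \<notin> R" "x \<notin> S"
        using u v verts by (auto simp: S_def H_eq)
      then show ?thesis using 6 in_arcsD1 by (auto simp: e Z_def)
    next
      case 7
      then have "y \<notin> {u, v}" "y \<notin> P" "y \<notin> Q" "y \<notin> R" "y \<notin> S"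
        using u v verts by (auto simp: S_def H_eq)
      then show ?thesis using 7 in_arcsD2 by (auto simp: e Z_def)
    qed
  qed
  have S_sub: "S \<subseteq> P \<union> Q \<union> R" by (auto simp: S_def H_eq)
  have Z_sub: "Z \<subseteq> R \<times> R" by (auto simp: Z_def)
  show ?thesis
  proof (cases "card P \<le> card Q")
    case True
    interpret pendant_core G u v P Q R S Z
      by unfold_locales
        (use verts v notin disj S_sub Z_sub arcs pP qQ S_nonempty True bicyclic no_twins in auto)
    show ?thesis by (rule rank_4_shape)
  next
    case False
    interpret pendant_core G u v Q P R S Z
    proof
      show "pverts G = {u, v} \<union> (Q \<union> P \<union> R)" using verts by (simp add: Un_ac)
      show "parcs G = {(u, v), (v, u)} \<union> {v} \<times> S \<union> S \<times> {v} \<union> Q \<times> P \<union> P \<times> Q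
          \<union> (Q \<union> P) \<times> R \<union> R \<times> (Q \<union> P) \<union> Z"
        unfolding arcs by (simp only: Un_ac)
    qed (use v notin disj S_sub Z_sub pP qQ S_nonempty False bicyclic no_twins in auto)
    show ?thesis by (rule rank_4_shape)
  qed
qed

end

section \<open>The bicyclic gain graphs of rank 4\<close>

theorem theorem4p2:
  fixes G :: "'a pair_pre_digraph" and \<phi> :: "'a \<times> 'a \<Rightarrow> complex"
    and vs :: "'n::finite \<Rightarrow> 'a"
  assumes "gain_graph G \<phi>"
    and "bicyclic G"
    and "\<exists>u. pendant G u"
    and "\<not> (\<exists>u w. pendant_twins G u w)"
    and "bij_betw vs UNIV (pverts G)"
  shows "rank (adjacency_matrix G \<phi> vs) = 4 \<longleftrightarrow>
     \<comment> \<open>G12\<close>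
     (\<exists>f. labelling f (attach_pendant graph_K 4 5) G \<and> type_E \<phi> (map f [1, 2, 3])) \<or>
     \<comment> \<open>G13\<close>
     (\<exists>u\<in>pverts graph_K. out_degree (with_proj graph_K) u = 3 \<and>
        (\<exists>f. labelling f (attach_pendant graph_K u 5) G)) \<or>
     \<comment> \<open>G14\<close>
     (\<exists>u\<in>pverts graph_K. \<exists>w\<in>pverts graph_K. u \<noteq> w \<and>
        out_degree (with_proj graph_K) u = 3 \<and> out_degree (with_proj graph_K) w = 3 \<and>
        (\<exists>f. labelling f (attach_pendant (attach_pendant graph_K u 5) w 6) G)) \<or>
     \<comment> \<open>G15, G16\<close>
     (\<exists>u\<in>pverts graph_K. out_degree (with_proj graph_K) u \<in> {2, 3} \<and>
        (\<exists>f. labelling f (attach_P2 graph_K u 5 6) G \<and>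
             type_E \<phi> (map f [1, 2, 3]) \<and> type_A \<phi> (map f [1, 2, 4, 3]))) \<or>
     \<comment> \<open>G17\<close>
     (\<exists>f. labelling f (attach_pendant graph_L 5 6) G \<and> type_A \<phi> (map f [1, 2, 3, 4])) \<or>
     \<comment> \<open>G18\<close>
     (\<exists>f. labelling f (attach_pendant graph_M 5 6) G \<and> type_A \<phi> (map f [1, 2, 3, 4])) \<or>
     \<comment> \<open>G19\<close>
     (\<exists>u\<in>pverts graph_M. out_degree (with_proj graph_M) u = 3 \<and>
        (\<exists>f. labelling f (attach_pendant graph_M u 6) G)) \<or>
     \<comment> \<open>G20\<close>
     (\<exists>u\<in>pverts graph_M. \<exists>w\<in>pverts graph_M. u \<noteq> w \<and>
        out_degree (with_proj graph_M) u = 3 \<and> out_degree (with_proj graph_M) w = 3 \<and>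
        (\<exists>f. labelling f (attach_pendant (attach_pendant graph_M u 6) w 7) G)) \<or>
     \<comment> \<open>G21, G22\<close>
     (\<exists>u\<in>pverts graph_M. out_degree (with_proj graph_M) u \<in> {2, 3} \<and>
        (\<exists>f. labelling f (attach_P2 graph_M u 6 7) G \<and>
             type_A \<phi> (map f [1, 2, 3, 4]) \<and> type_A \<phi> (map f [1, 2, 5, 4])))"
    (is "?rank = 4 \<longleftrightarrow> ?G12 \<or> ?G13 \<or> ?G14 \<or> ?G15_G16 \<or> ?G17 \<or> ?G18 \<or> ?G19 \<or> ?G20 \<or> ?G21_G22")
proof -
  interpret gain_graph G \<phi> by fact
  note bij = assms(5)
  have pverts_K: "pverts graph_K = {1, 2, 3, 4}" and pverts_M: "pverts graph_M = {1, 2, 3, 4, 5}"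
    by (simp_all add: graph_K_def graph_M_def pverts_simple_graph)
  have degree_K: "out_degree (with_proj graph_K) u = 3 \<longleftrightarrow> u \<in> {2, 3}"
    "u \<in> pverts graph_K \<Longrightarrow> out_degree (with_proj graph_K) u \<in> {2, 3}" for u
    by (auto simp: out_degree_graph_K pverts_K)
  have degree_M: "out_degree (with_proj graph_M) u = 3 \<longleftrightarrow> u \<in> {2, 4}"
    "u \<in> pverts graph_M \<Longrightarrow> out_degree (with_proj graph_M) u \<in> {2, 3}" for u
    by (auto simp: out_degree_graph_M pverts_M)
  show ?thesis
  proof
    assume rank: "?rank = 4"
    then have "rank_4_shape G" by (rule shape_of_rank_eq_4[OF bij assms(2-4)])
    then obtain f where "labelling f (attach_pendant graph_K 4 5) G \<or>
     labelling f (attach_pendant graph_K 2 5) G \<or>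
     labelling f (attach_pendant (attach_pendant graph_K 2 5) 3 6) G \<or>
     (\<exists>t \<in> pverts graph_K. labelling f (attach_P2 graph_K t 5 6) G) \<or>
     labelling f (attach_pendant graph_L 5 6) G \<or>
     labelling f (attach_pendant graph_M 5 6) G \<or>
     labelling f (attach_pendant graph_M 2 6) G \<or>
     labelling f (attach_pendant (attach_pendant graph_M 2 6) 4 7) G \<or>
     (\<exists>t \<in> pverts graph_M. labelling f (attach_P2 graph_M t 6 7) G)"
      unfolding rank_4_shape_def by blast
    then show "?G12 \<or> ?G13 \<or> ?G14 \<or> ?G15_G16 \<or> ?G17 \<or> ?G18 \<or> ?G19 \<or> ?G20 \<or> ?G21_G22"
    proof (elim disjE bexE)
      assume "labelling f (attach_pendant graph_K 4 5) G"
      then have ?G12 using rank rank_C3_core[OF bij] by blast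
      then show ?thesis by blast
    next
      assume "labelling f (attach_pendant graph_K 2 5) G"
      moreover have "2 \<in> pverts graph_K" by (simp add: pverts_K)
      ultimately have ?G13 using degree_K(1)[of 2] by blast
      then show ?thesis by blast
    next
      assume "labelling f (attach_pendant (attach_pendant graph_K 2 5) 3 6) G"
      moreover have "2 \<in> pverts graph_K" "3 \<in> pverts graph_K" "2 \<noteq> (3::nat)" by (simp_all add: pverts_K)
      ultimately have ?G14 using degree_K(1)[of 2] degree_K(1)[of 3] by blast
      then show ?thesis by blast
    next
      fix t assume "t \<in> pverts graph_K" "labelling f (attach_P2 graph_K t 5 6) G"
      then have ?G15_G16 using rank rank_K_core[OF bij] degree_K(2) by blast
      then show ?thesis by blast
    next
      assume "labelling f (attach_pendant graph_L 5 6) G"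
      then have ?G17 using rank rank_C4_core[OF bij] by blast
      then show ?thesis by blast
    next
      assume "labelling f (attach_pendant graph_M 5 6) G"
      then have ?G18 using rank rank_C4_core[OF bij] by blast
      then show ?thesis by blast
    next
      assume "labelling f (attach_pendant graph_M 2 6) G"
      moreover have "2 \<in> pverts graph_M" by (simp add: pverts_M)
      ultimately have ?G19 using degree_M(1)[of 2] by blast
      then show ?thesis by blast
    next
      assume "labelling f (attach_pendant (attach_pendant graph_M 2 6) 4 7) G"
      moreover have "2 \<in> pverts graph_M" "4 \<in> pverts graph_M" "2 \<noteq> (4::nat)" by (simp_all add: pverts_M)
      ultimately have ?G20 using degree_M(1)[of 2] degree_M(1)[of 4] by blast
      then show ?thesis by blast
    next
      fix t assume "t \<in> pverts graph_M" "labelling f (attach_P2 graph_M t 6 7) G"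
      then have ?G21_G22 using rank rank_K23_core[OF bij] degree_M(2) by blast
      then show ?thesis by blast
    qed
  next
    assume "?G12 \<or> ?G13 \<or> ?G14 \<or> ?G15_G16 \<or> ?G17 \<or> ?G18 \<or> ?G19 \<or> ?G20 \<or> ?G21_G22"
    then show "?rank = 4"
    proof (elim disjE)
      assume ?G12 then show ?thesis using rank_C3_core[OF bij] by blast
    next
      assume ?G13 then show ?thesis using rank_K_pendant[OF bij] degree_K(1) by blast
    next
      assume ?G14 then show ?thesis using rank_K_two_pendants[OF bij] degree_K(1) by blast
    next
      assume ?G15_G16 then show ?thesis using rank_K_core[OF bij] by blast
    next
      assume ?G17 then show ?thesis using rank_C4_core[OF bij] by blast
    next
      assume ?G18 then show ?thesis using rank_C4_core[OF bij] by blast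
    next
      assume ?G19 then show ?thesis using rank_M_pendant[OF bij] degree_M(1) by blast
    next
      assume ?G20 then show ?thesis using rank_M_two_pendants[OF bij] degree_M(1) by blast
    next
      assume ?G21_G22 then show ?thesis using rank_K23_core[OF bij] by blast
    qed
  qed
qed

end
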